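(* Consider the graph exploration problem with predictions on trees (defined in the context). For every constant $\delta>0$ there is a deterministic exploration algorithm (taking $\delta$ as a parameter) such that, on every unweighted tree $T$ with maximum degree $\Delta$, every root $r$, every goal $g$ and every prediction function $f:V(T)\to\mathbb{Z}$, the total movement cost incurred before reaching $g$ is at most \[ d(r,g)(1+\delta) + O\!\left(\frac{\Delta\cdot|\mathcal{E}|}{\delta}\right), \] where $\mathcal{E}=\{v\in V(T)\mid f(v)\neq d(v,g)\}$ and the constant hidden in $O(\cdot)$ is absolute.
   Context: Exploration problem: an agent moves in an unknown unweighted (unit edge length) tree $T=(V,E)$, starting at a known root $v_0=r$, searching for an unknown goal vertex $g$; the agent learns that a vertex is the goal only when it visits it. Each vertex $v$ carries a prediction $f(v)\in\mathbb{Z}$ of its distance $d(v,g)$ to the goal. At the start of time $t\ge 1$ the agent knows the set $V_{t-1}=\{v_0,\dots,v_{t-1}\}$ of visited vertices, the set $\partial V_{t-1}$ of vertices not in $V_{t-1}$ having a neighbor in $V_{t-1}$, the edges among these, and the predictions $f(v)$ for all $v\in V_{t-1}\cup\partial V_{t-1}$. It chooses a new vertex $v_t\in\partial V_{t-1}$, paying cost $d(v_{t-1},v_t)$ (tree distance), and then observes the neighbors of $v_t$ and their predictions. The process stops when $v_t=g$; the cost is $\sum_t d(v_{t-1},v_t)$ up to that time. Here $d$ denotes the shortest-path distance in $T$, and the set of erroneous vertices is $\mathcal{E}=\{v\in V\mid f(v)\neq d(v,g)\}$.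
   Formalization: The error term is O(Δ|ℰ|/min(δ,1)) instead of O(Δ|ℰ|/δ): the same for δ ≤ 1; for unbounded δ the stated bound with an absolute constant is false (complete binary trees with f = −1 everywhere and δ = 6C). Trees are finite, with vertices labelled by natural numbers. *)

theory Defs
  imports Complex_Main
begin

section \<open>Finite simple graphs and trees\<close>

text \<open>
  A graph is given by its vertex set \<open>V\<close> and its set \<open>E\<close> of edges, which are two-element
  subsets of \<open>V\<close>.
\<close>

definition simple_graph :: "'v set \<Rightarrow> 'v set set \<Rightarrow> bool" where
  "simple_graph V E \<longleftrightarrow> finite V \<and> (\<forall>e\<in>E. e \<subseteq> V \<and> card e = 2)"

definition walk :: "'v set \<Rightarrow> 'v set set \<Rightarrow> 'v list \<Rightarrow> bool" where
  "walk V E p \<longleftrightarrow> p \<noteq> [] \<and> set p \<subseteq> V \<and> successively (\<lambda>u v. {u, v} \<in> E) p"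

definition walk_betw :: "'v set \<Rightarrow> 'v set set \<Rightarrow> 'v \<Rightarrow> 'v list \<Rightarrow> 'v \<Rightarrow> bool" where
  "walk_betw V E u p v \<longleftrightarrow> walk V E p \<and> hd p = u \<and> last p = v"

definition graph_connected :: "'v set \<Rightarrow> 'v set set \<Rightarrow> bool" where
  "graph_connected V E \<longleftrightarrow> V \<noteq> {} \<and> (\<forall>u\<in>V. \<forall>v\<in>V. \<exists>p. walk_betw V E u p v)"

definition graph_cycle :: "'v set \<Rightarrow> 'v set set \<Rightarrow> 'v list \<Rightarrow> bool" where
  "graph_cycle V E p \<longleftrightarrow> walk V E p \<and> distinct p \<and> length p \<ge> 3 \<and> {last p, hd p} \<in> E"

definition is_tree :: "'v set \<Rightarrow> 'v set set \<Rightarrow> bool" where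
  "is_tree V E \<longleftrightarrow> simple_graph V E \<and> graph_connected V E \<and> (\<nexists>p. graph_cycle V E p)"

definition vertex_degree :: "'v set set \<Rightarrow> 'v \<Rightarrow> nat" where
  "vertex_degree E v = card {e \<in> E. v \<in> e}"

definition max_degree :: "'v set \<Rightarrow> 'v set set \<Rightarrow> nat" where
  "max_degree V E = Max (vertex_degree E ` V)"

text \<open>A walk with \<open>n\<close> edges is a list of \<open>Suc n\<close> vertices; all edges have length one.\<close>

definition graph_dist :: "'v set \<Rightarrow> 'v set set \<Rightarrow> 'v \<Rightarrow> 'v \<Rightarrow> nat" where
  "graph_dist V E u v = (LEAST n. \<exists>p. walk_betw V E u p v \<and> length p = Suc n)"


section \<open>Exploration with predictions\<close>

definition boundary :: "'v set \<Rightarrow> 'v set set \<Rightarrow> 'v set \<Rightarrow> 'v set" where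
  "boundary V E S = {v \<in> V - S. \<exists>u\<in>S. {u, v} \<in> E}"

text \<open>
  All that the agent knows before a move. The visited vertices are kept in the order of the
  visits, so the root is the first and the current position the last entry of the list.
  Predictions of vertices that the agent has not seen are \<open>None\<close>.
\<close>

record 'v observation =
  obs_visited :: "'v list"
  obs_boundary :: "'v set"
  obs_edges :: "'v set set"
  obs_pred :: "'v \<Rightarrow> int option"

definition observe :: "'v set \<Rightarrow> 'v set set \<Rightarrow> ('v \<Rightarrow> int) \<Rightarrow> 'v list \<Rightarrow> 'v observation" where
  "observe V E f vs =
    (let B = boundary V E (set vs); K = set vs \<union> B in
      \<lparr> obs_visited = vs,
        obs_boundary = B,
        obs_edges = {e \<in> E. e \<subseteq> K},
        obs_pred = (\<lambda>v. if v \<in> K then Some (f v) else None) \<rparr>)"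

text \<open>
  A deterministic algorithm is a function of the observation alone: neither the unseen part of
  the tree nor the goal is an argument. That the goal has not been visited yet is implicit, since
  the cost is only counted up to the first visit to the goal.
\<close>

definition exploration_algorithm :: "('v observation \<Rightarrow> 'v) \<Rightarrow> bool" where
  "exploration_algorithm A \<longleftrightarrow> (\<forall>ob. obs_boundary ob \<noteq> {} \<longrightarrow> A ob \<in> obs_boundary ob)"

text \<open>
  The list \<open>v\<^sub>0, \<dots>, v\<^sub>t\<close>. Once every vertex has been visited the boundary is empty and
  the further entries are arbitrary; the goal has been visited by then.
\<close>

primrec visits ::
  "('v observation \<Rightarrow> 'v) \<Rightarrow> 'v set \<Rightarrow> 'v set set \<Rightarrow> ('v \<Rightarrow> int) \<Rightarrow> 'v \<Rightarrow> nat \<Rightarrow> 'v list" where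
  "visits A V E f r 0 = [r]"
| "visits A V E f r (Suc t) =
    visits A V E f r t @ [A (observe V E f (visits A V E f r t))]"

definition position ::
  "('v observation \<Rightarrow> 'v) \<Rightarrow> 'v set \<Rightarrow> 'v set set \<Rightarrow> ('v \<Rightarrow> int) \<Rightarrow> 'v \<Rightarrow> nat \<Rightarrow> 'v" where
  "position A V E f r t = last (visits A V E f r t)"

definition first_reaches ::
  "('v observation \<Rightarrow> 'v) \<Rightarrow> 'v set \<Rightarrow> 'v set set \<Rightarrow> ('v \<Rightarrow> int) \<Rightarrow> 'v \<Rightarrow> 'v \<Rightarrow> nat \<Rightarrow> bool" where
  "first_reaches A V E f r g n \<longleftrightarrow>
    position A V E f r n = g \<and> (\<forall>t<n. position A V E f r t \<noteq> g)"

definition movement_cost ::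
  "('v observation \<Rightarrow> 'v) \<Rightarrow> 'v set \<Rightarrow> 'v set set \<Rightarrow> ('v \<Rightarrow> int) \<Rightarrow> 'v \<Rightarrow> nat \<Rightarrow> nat" where
  "movement_cost A V E f r n =
    (\<Sum>t = 1..n. graph_dist V E (position A V E f r (t - 1)) (position A V E f r t))"

definition erroneous :: "'v set \<Rightarrow> 'v set set \<Rightarrow> ('v \<Rightarrow> int) \<Rightarrow> 'v \<Rightarrow> 'v set" where
  "erroneous V E f g = {v \<in> V. f v \<noteq> int (graph_dist V E v g)}"

end

theory Submission
  imports Defs
begin

text \<open>
  Suppose first that the distance from some root \<open>c\<close> to the goal is known. An unvisited vertex \<open>b\<close>,
  taken as a hypothesis on the branch that holds the goal, then predicts the value \<open>f v\<close> of every
  visited \<open>v\<close>; the true hypothesis makes at most \<open>2 |\<E>|\<close> mistakes. The agent moves to the hypothesis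
  that minimises four times the number of mistakes plus twice the distance it has to walk up
  towards \<open>c\<close>. If it enters a branch forking off the true path at \<open>m\<close>, every correct vertex of the
  branch speaks against the branch, so its size is bounded by the number of wrong vertices in it, plus those that wrongly name
  \<open>m\<close> as the place where the goal path leaves. A vertex names only one \<open>m\<close>, and \<open>m\<close> has at most \<open>\<Delta>\<close>
  branches, so \<open>O(\<Delta> |\<E>|)\<close> vertices are visited off the path. Upward moves are paid by the growth of
  the number of mistakes of the current hypothesis. When the current branch is exhausted, the jump
  of this number is paid by wrong vertices that are charged once per child of the vertex they name.

  The distance is guessed at a median \<open>c\<close> of the first \<open>O(B)\<close> visited vertices, where \<open>B\<close> bounds \<open>|\<E>|\<close>:
  at least half of them see the goal through \<open>c\<close>, which leaves at most four candidates. The bound \<open>B\<close> is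
  doubled whenever all candidates have made too many mistakes. Measured by the depth below \<open>r\<close>, the
  progress of all runs telescopes to \<open>d(r,g)\<close>, so the total cost is \<open>d(r,g) + O(\<Delta> |\<E>|)\<close>.
\<close>

section \<open>Distances in trees\<close>

locale tree =
  fixes V :: "'a set" and E :: "'a set set"
  assumes tree: "is_tree V E"
begin

abbreviation d :: "'a \<Rightarrow> 'a \<Rightarrow> nat" where "d \<equiv> graph_dist V E"

lemma adj_V: "{u, v} \<in> E \<Longrightarrow> u \<in> V \<and> v \<in> V \<and> u \<noteq> v"
  using tree unfolding is_tree_def simple_graph_def by (auto simp: card_2_iff doubleton_eq_iff)

lemma finite_V: "finite V"
  using tree unfolding is_tree_def simple_graph_def by auto

lemma finite_E: "finite E"
proof (rule finite_subset)
  show "E \<subseteq> Pow V"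
    using tree unfolding is_tree_def simple_graph_def by auto
qed (simp add: finite_V)

lemma walk_snoc:
  assumes "walk_betw V E u p w" "{w, v} \<in> E"
  shows "walk_betw V E u (p @ [v]) v"
  using assms adj_V[OF assms(2)] unfolding walk_betw_def walk_def
  by (auto simp: successively_append_iff)

lemma walk_rev:
  assumes "walk_betw V E u p v"
  shows "walk_betw V E v (rev p) u"
  using assms unfolding walk_betw_def walk_def
  by (auto simp: successively_rev hd_rev last_rev insert_commute)

lemma walk_split_last:
  assumes "walk_betw V E u p v" "length p = Suc (Suc k)"
  obtains q w where "p = q @ [v]" "walk_betw V E u q w" "{w, v} \<in> E" "length q = Suc k"
proof -
  obtain q where q: "p = q @ [v]" "q \<noteq> []"
    using assms unfolding walk_betw_def
    by (metis append_butlast_last_id append_self_conv2 length_0_conv length_append_singleton nat.inject old.nat.distinct(2))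
  moreover have "walk_betw V E u q (last q)" "{last q, v} \<in> E"
    using assms q unfolding walk_betw_def walk_def by (auto simp: successively_append_iff)
  ultimately show thesis using assms that by auto
qed

lemma d_wit:
  assumes "u \<in> V" "v \<in> V"
  shows "\<exists>p. walk_betw V E u p v \<and> length p = Suc (d u v)"
proof -
  obtain p where p: "walk_betw V E u p v"
    using assms tree unfolding is_tree_def graph_connected_def by blast
  then obtain n where "length p = Suc n"
    unfolding walk_betw_def walk_def by (cases p) auto
  with p have "\<exists>n p. walk_betw V E u p v \<and> length p = Suc n" by blast
  from LeastI_ex[OF this] show ?thesis unfolding graph_dist_def .
qed

lemma d_le: "walk_betw V E u p v \<Longrightarrow> length p = Suc n \<Longrightarrow> d u v \<le> n"
  unfolding graph_dist_def by (rule Least_le) blast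

lemma d_self[simp]: "u \<in> V \<Longrightarrow> d u u = 0"
  using d_le[of u "[u]" u 0] by (simp add: walk_betw_def walk_def)

lemma d_0:
  assumes "u \<in> V" "v \<in> V" "d u v = 0"
  shows "u = v"
proof -
  obtain p where "walk_betw V E u p v" "length p = Suc 0" using d_wit assms by metis
  then show ?thesis unfolding walk_betw_def by (cases p) auto
qed

lemma d_sym:
  assumes "u \<in> V" "v \<in> V"
  shows "d u v = d v u"
proof -
  have "d v u \<le> d u v" if uv: "u \<in> V" "v \<in> V" for u v
  proof -
    obtain p where "walk_betw V E u p v" "length p = Suc (d u v)" using d_wit[OF uv] by blast
    then show ?thesis using d_le[OF walk_rev] by simp
  qed
  then show ?thesis using assms by (meson le_antisym)
qed

lemma d_adj_le:
  assumes "u \<in> V" "{w, v} \<in> E"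
  shows "d u v \<le> Suc (d u w)"
proof -
  obtain p where "walk_betw V E u p w" "length p = Suc (d u w)"
    using d_wit[of u w] adj_V[OF assms(2)] assms by blast
  then show ?thesis using d_le[OF walk_snoc[OF _ assms(2)]] by simp
qed

lemma d_step:
  assumes "u \<in> V" "v \<in> V" "d u v = Suc k"
  obtains w where "{w, v} \<in> E" "d u w = k" "w \<in> V"
proof -
  obtain p where p: "walk_betw V E u p v" "length p = Suc (Suc k)" using d_wit assms by metis
  then obtain q w where q: "p = q @ [v]" "walk_betw V E u q w" "{w, v} \<in> E" "length q = Suc k"
    by (rule walk_split_last)
  then have "d u w \<le> k" using d_le by blast
  moreover have "Suc k \<le> Suc (d u w)" using d_adj_le[OF assms(1) q(3)] assms by simp
  ultimately show thesis using that[OF q(3)] adj_V[OF q(3)] by simp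
qed

lemma d_triangle:
  assumes "u \<in> V" "v \<in> V" "w \<in> V"
  shows "d u w \<le> d u v + d v w"
  using assms(3)
proof (induction "d v w" arbitrary: w)
  case 0
  then show ?case using d_0[OF assms(2) 0(2)] by simp
next
  case (Suc k)
  then obtain w' where w': "{w', w} \<in> E" "d v w' = k" "w' \<in> V"
    using d_step[of v w k] assms by metis
  have "d u w' \<le> d u v + d v w'" using Suc w' by auto
  then show ?case using d_adj_le[OF assms(1) w'(1)] Suc(2) w'(2) by linarith
qed

text \<open>Two vertices on the same level are joined by a path below that level; adding an edge or a
  common upper neighbour would close a cycle.\<close>

lemma level_path:
  assumes "c \<in> V" "u \<in> V" "v \<in> V" "u \<noteq> v" "d c u = k" "d c v = k"
  shows "\<exists>p. walk_betw V E u p v \<and> distinct p \<and> 3 \<le> length p \<and> (\<forall>w\<in>set p. d c w \<le> k)"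
  using assms
proof (induction k arbitrary: u v)
  case 0
  then show ?case using d_0 by metis
next
  case (Suc k)
  obtain u' where u': "{u', u} \<in> E" "d c u' = k" "u' \<in> V" using d_step[of c u k] Suc by metis
  obtain v' where v': "{v', v} \<in> E" "d c v' = k" "v' \<in> V" using d_step[of c v k] Suc by metis
  show ?case
  proof (cases "u' = v'")
    case True
    have "walk_betw V E u [u, u', v] v"
      using u' v' True Suc.prems unfolding walk_betw_def walk_def by (auto simp: insert_commute)
    moreover have "distinct [u, u', v]" using u' v' True Suc.prems by auto
    ultimately show ?thesis using Suc.prems u' by (intro exI[of _ "[u, u', v]"]) auto
  next
    case False
    then obtain p where p: "walk_betw V E u' p v'" "distinct p" "3 \<le> length p"
      "\<forall>w\<in>set p. d c w \<le> k" using Suc u' v' by metis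
    have "walk_betw V E u (rev (rev p @ [u])) v'"
      by (rule walk_rev, rule walk_snoc[OF walk_rev[OF p(1)] u'(1)])
    then have "walk_betw V E u (rev (rev p @ [u]) @ [v]) v" using walk_snoc v' by blast
    moreover have "distinct (rev (rev p @ [u]) @ [v])" using p Suc.prems by auto
    ultimately show ?thesis using p Suc.prems
      by (intro exI[of _ "rev (rev p @ [u]) @ [v]"]) auto
  qed
qed

lemma adj_d_neq:
  assumes "c \<in> V" "{u, v} \<in> E"
  shows "d c u \<noteq> d c v"
proof
  assume eq: "d c u = d c v"
  obtain p where p: "walk_betw V E u p v" "distinct p" "3 \<le> length p"
    using level_path[of c u v "d c v"] eq assms adj_V[OF assms(2)] by auto
  then have "graph_cycle V E p"
    using assms unfolding graph_cycle_def walk_betw_def by (auto simp: insert_commute)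
  then show False using tree unfolding is_tree_def by blast
qed

lemma adj_d_cases:
  assumes "c \<in> V" "{u, v} \<in> E"
  shows "d c u = Suc (d c v) \<or> d c v = Suc (d c u)"
  using adj_d_neq[OF assms] d_adj_le[OF assms] d_adj_le[of c v u] assms
  by (auto simp: insert_commute)

lemma parent_unique:
  assumes "c \<in> V" "{u, w} \<in> E" "{v, w} \<in> E" "d c w = Suc (d c u)" "d c w = Suc (d c v)"
  shows "u = v"
proof (rule ccontr)
  assume "u \<noteq> v"
  then obtain p where p: "walk_betw V E u p v" "distinct p" "3 \<le> length p" "\<forall>x\<in>set p. d c x \<le> d c u"
    using level_path[of c u v "d c u"] assms adj_V by (metis nat.inject)
  then have "walk_betw V E u (p @ [w]) w" using walk_snoc assms by blast
  moreover have "distinct (p @ [w])" using p assms(4) by auto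
  ultimately have "graph_cycle V E (p @ [w])"
    using assms p unfolding graph_cycle_def walk_betw_def by (auto simp: insert_commute)
  then show False using tree unfolding is_tree_def by blast
qed

text \<open>Induction along the path from \<open>w'\<close> to \<open>y\<close>. Were the last
  vertex nearer to \<open>x\<close> than its predecessor, it would be the parent of the predecessor
  seen from \<open>x\<close>; but that parent is already \<open>w\<close> or the vertex before the
  predecessor.\<close>

lemma edge_separates:
  assumes "x \<in> V" "y \<in> V" "{w, w'} \<in> E" "d x w' = Suc (d x w)" "d y w = Suc (d y w')"
  shows "d x y = d x w + 1 + d w' y"
  using assms(2,5)
proof (induction "d w' y" arbitrary: y rule: less_induct)
  case less
  note W = adj_V[OF assms(3)]
  show ?case
  proof (cases "d w' y")
    case 0
    then have "y = w'" using d_0 W less.prems by blast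
    then show ?thesis using assms W by simp
  next
    case (Suc k)
    then obtain y' where y': "{y', y} \<in> E" "d w' y' = k" "y' \<in> V"
      using d_step W less.prems by metis
    have side: "d y' w = Suc (d y' w')"
    proof -
      have "d w y \<le> Suc (d w y')" using d_adj_le[OF _ y'(1)] W by simp
      moreover have "d w y = Suc (Suc k)" using less.prems Suc d_sym W by metis
      ultimately have "d y' w \<ge> Suc (d y' w')" using y' d_sym W by (metis Suc_le_mono)
      then show ?thesis using adj_d_cases[OF y'(3) assms(3)] by auto
    qed
    have IH: "d x y' = d x w + 1 + k" using less.hyps[OF _ y'(3) side] y' Suc by simp
    have "d x y \<noteq> d x w + k"
    proof
      assume bad: "d x y = d x w + k"
      show False
      proof (cases k)
        case 0
        then have y'w: "y' = w'" using d_0 W y' by blast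
        have "y = w"
          using parent_unique[OF assms(1), of y w' w] y' y'w bad 0 assms IH
          by (auto simp: insert_commute)
        then show False using less.prems W by simp
      next
        case (Suc j)
        obtain y'' where y'': "{y'', y'} \<in> E" "d w' y'' = j" "y'' \<in> V"
          using d_step[of w' y' j] W y' Suc by metis
        have "d w y' \<le> Suc (d w y'')" using d_adj_le[OF _ y''(1)] W by simp
        then have "d y'' w \<ge> Suc (d y'' w')" using y'' y' side Suc d_sym W by (metis Suc_le_mono)
        then have "d y'' w = Suc (d y'' w')" using adj_d_cases[OF y''(3) assms(3)] by auto
        then have "d x y'' = d x w + 1 + j" using less.hyps[OF _ y''(3)] y'' \<open>d w' y = Suc k\<close> Suc by simp
        then have "y = y''"
          using parent_unique[OF assms(1), of y y' y''] y' y'' bad Suc IH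
          by (auto simp: insert_commute)
        then show False using y'' \<open>d w' y = Suc k\<close> Suc by simp
      qed
    qed
    then show ?thesis using adj_d_cases[OF assms(1) y'(1)] IH Suc by auto
  qed
qed

end

section \<open>Rooted trees\<close>

locale rooted_tree = tree +
  fixes c :: 'a
  assumes root: "c \<in> V"
begin

abbreviation dep :: "'a \<Rightarrow> nat" where "dep \<equiv> d c"

text \<open>The tree order, stated metrically: \<open>w\<close> lies on a shortest path from the
  root \<open>c\<close> to \<open>v\<close>. Transitivity then follows from the triangle
  inequality.\<close>

definition anc :: "'a \<Rightarrow> 'a \<Rightarrow> bool" where
  "anc w v \<longleftrightarrow> w \<in> V \<and> v \<in> V \<and> dep v = dep w + d w v"

lemma anc_V: "anc w v \<Longrightarrow> w \<in> V \<and> v \<in> V"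
  unfolding anc_def by auto

lemma anc_refl: "v \<in> V \<Longrightarrow> anc v v"
  unfolding anc_def by simp

lemma anc_root: "v \<in> V \<Longrightarrow> anc c v"
  unfolding anc_def using root by simp

lemma anc_dep: "anc w v \<Longrightarrow> dep w \<le> dep v"
  unfolding anc_def by simp

lemma anc_eq: "anc w v \<Longrightarrow> dep v \<le> dep w \<Longrightarrow> w = v"
  unfolding anc_def using d_0 by simp

lemma anc_trans:
  assumes "anc w v" "anc v x"
  shows "anc w x"
proof -
  have V: "w \<in> V" "v \<in> V" "x \<in> V" using assms anc_V by auto
  have "d w x \<le> d w v + d v x" "dep x \<le> dep w + d w x"
    using d_triangle[of w v x] d_triangle[of c w x] V root by auto
  then show ?thesis using assms V unfolding anc_def by auto
qed

lemma anc_adj: "{p, v} \<in> E \<Longrightarrow> dep v = Suc (dep p) \<Longrightarrow> anc p v"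
  using d_adj_le[of p p v] d_triangle[of c p v] root adj_V[of p v] unfolding anc_def by auto

lemma parent_ex:
  assumes "anc w v" "w \<noteq> v"
  obtains p where "{p, v} \<in> E" "dep v = Suc (dep p)" "anc w p" "p \<in> V"
proof -
  have V: "w \<in> V" "v \<in> V" using assms anc_V by auto
  have "d w v \<noteq> 0" using assms d_0 V by auto
  then obtain k where k: "d w v = Suc k" by (cases "d w v") auto
  obtain p where p: "{p, v} \<in> E" "d w p = k" "p \<in> V" using d_step[OF V k] .
  have "dep p \<le> dep w + k" using d_triangle[of c w p] p V root by auto
  moreover have "dep v = dep w + Suc k" using assms k unfolding anc_def by simp
  ultimately have v: "dep v = Suc (dep p)" using adj_d_cases[OF root p(1)] by linarith
  moreover have "dep p = dep w + d w p" using v \<open>dep v = dep w + Suc k\<close> p(2) by linarith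
  ultimately show thesis using that[OF p(1)] p(3) V unfolding anc_def by blast
qed

lemma anc_parent:
  assumes "{p, v} \<in> E" "dep v = Suc (dep p)" "anc w v" "w \<noteq> v"
  shows "anc w p"
proof -
  obtain p' where "{p', v} \<in> E" "dep v = Suc (dep p')" "anc w p'"
    by (rule parent_ex[OF assms(3,4)])
  then show ?thesis using parent_unique[OF root _ assms(1) _ assms(2)] by blast
qed

lemma anc_at:
  assumes "v \<in> V" "k \<le> dep v"
  obtains w where "anc w v" "dep w = k"
proof -
  have "\<exists>w. anc w v \<and> dep w = k" using assms
  proof (induction "dep v - k" arbitrary: v)
    case 0
    then show ?case using anc_refl by auto
  next
    case (Suc n)
    then have "c \<noteq> v" using root by auto
    then obtain p where p: "{p, v} \<in> E" "dep v = Suc (dep p)" "p \<in> V"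
      using parent_ex[OF anc_root[OF Suc.prems(1)]] by blast
    then have "n = dep p - k" "k \<le> dep p" using Suc.hyps(2) by auto
    then obtain w where "anc w p" "dep w = k" using Suc p by blast
    then show ?case using anc_trans anc_adj[OF p(1,2)] by blast
  qed
  then show thesis using that by blast
qed

lemma anc_unique:
  assumes "anc w v" "anc w' v" "dep w = dep w'"
  shows "w = w'"
  using assms
proof (induction "d w v" arbitrary: v)
  case 0
  then have "w = v" using d_0[of w v] anc_V[of w v] by simp
  then show ?case using anc_eq[of w' v] 0 by auto
next
  case (Suc n)
  have "w \<noteq> v" using Suc.hyps(2) anc_V[OF Suc.prems(1)] by auto
  then obtain p where p: "{p, v} \<in> E" "dep v = Suc (dep p)" "anc w p"
    by (rule parent_ex[OF Suc.prems(1)])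
  have "w' \<noteq> v" using Suc p anc_dep[of w p] by auto
  then have "anc w' p" using anc_parent p Suc by blast
  moreover have "n = d w p" using Suc p unfolding anc_def by auto
  ultimately show ?case using Suc p by blast
qed

lemma anc_chain:
  assumes "anc w v" "anc w' v" "dep w \<le> dep w'"
  shows "anc w w'"
proof -
  have "w' \<in> V" using assms(2) anc_V by blast
  then obtain y where y: "anc y w'" "dep y = dep w" using assms(3) by (rule anc_at)
  then have "y = w" using anc_unique[OF anc_trans[OF y(1) assms(2)] assms(1)] by simp
  then show ?thesis using y by simp
qed

lemma anc_strict_dep: "anc w v \<Longrightarrow> w \<noteq> v \<Longrightarrow> dep w < dep v"
  using anc_eq[of w v] by linarith

lemma child_ex:
  assumes "anc w v" "w \<noteq> v"
  shows "\<exists>k. {w, k} \<in> E \<and> dep k = Suc (dep w) \<and> anc k v"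
proof -
  have "Suc (dep w) \<le> dep v" using anc_strict_dep[OF assms] by simp
  moreover have "v \<in> V" using assms(1) anc_V by blast
  ultimately obtain k where k: "anc k v" "dep k = Suc (dep w)" by (metis anc_at)
  then have "anc w k" using anc_chain[OF assms(1) k(1)] by simp
  moreover have "w \<noteq> k" using k(2) by force
  ultimately obtain p where p: "{p, k} \<in> E" "dep k = Suc (dep p)" "anc w p"
    by (rule parent_ex)
  then have "p = w" using anc_eq[of w p] k(2) by simp
  then show ?thesis using p k by auto
qed

definition toward :: "'a \<Rightarrow> 'a \<Rightarrow> 'a" where
  "toward w v = (SOME k. {w, k} \<in> E \<and> dep k = Suc (dep w) \<and> anc k v)"

lemma toward:
  assumes "anc w v" "w \<noteq> v"
  shows "{w, toward w v} \<in> E" "dep (toward w v) = Suc (dep w)" "anc (toward w v) v"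
    "anc w (toward w v)"
proof -
  have "{w, toward w v} \<in> E \<and> dep (toward w v) = Suc (dep w) \<and> anc (toward w v) v"
    unfolding toward_def by (rule someI_ex[OF child_ex[OF assms]])
  then show "{w, toward w v} \<in> E" "dep (toward w v) = Suc (dep w)" "anc (toward w v) v"
    "anc w (toward w v)"
    using anc_adj by blast+
qed

text \<open>Take the ancestor \<open>m\<close> of \<open>x\<close> that is nearest to
  \<open>z\<close>. The edge above \<open>m\<close> separates the root from \<open>z\<close>, so
  \<open>m\<close> is above \<open>z\<close>; the edge from \<open>m\<close> towards
  \<open>x\<close> separates \<open>x\<close> from \<open>z\<close>, so the path from
  \<open>x\<close> to \<open>z\<close> passes \<open>m\<close>.\<close>

lemma meet_ex:
  assumes "x \<in> V" "z \<in> V"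
  shows "\<exists>m. anc m x \<and> anc m z \<and> d x z = d x m + d m z"
proof -
  define m where "m = arg_min (\<lambda>m. d m z) (\<lambda>m. anc m x)"
  have m: "anc m x" unfolding m_def using arg_min_natI[of "\<lambda>m. anc m x" c] anc_root assms by auto
  have min: "d m z \<le> d y z" if "anc y x" for y
    unfolding m_def using arg_min_nat_le[of "\<lambda>m. anc m x" y] that by auto
  have mV: "m \<in> V" using m anc_V by auto
  have "anc m z"
  proof (cases "m = c")
    case False
    then obtain p where p: "{p, m} \<in> E" "dep m = Suc (dep p)" "p \<in> V"
      using parent_ex[OF anc_root[OF mV]] by blast
    have "d m z \<le> d p z" using min anc_trans anc_adj[OF p(1,2)] m by blast
    then have "d z p = Suc (d z m)"
      using adj_d_cases[OF assms(2) p(1)] d_sym[OF mV assms(2)] d_sym[OF p(3) assms(2)] by auto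
    then have "d c z = d c p + 1 + d m z" using edge_separates[OF root assms(2) p(1,2)] by simp
    then show ?thesis using p mV assms unfolding anc_def by auto
  qed (use anc_root assms in auto)
  moreover have "d x z = d x m + d m z"
  proof (cases "m = x")
    case False
    let ?k = "toward m x"
    note k = toward[OF m False]
    have kV: "?k \<in> V" using k anc_V by auto
    have "d m z \<le> d ?k z" using min k by blast
    then have 1: "d z ?k = Suc (d z m)"
      using adj_d_cases[OF assms(2) k(1)] d_sym[OF mV assms(2)] d_sym[OF kV assms(2)] by auto
    have "dep x = dep m + d m x" "dep x = dep ?k + d ?k x" using m k unfolding anc_def by auto
    then have "d x m = Suc (d x ?k)" using k d_sym[OF mV assms(1)] d_sym[OF kV assms(1)] by auto
    then show ?thesis using edge_separates[of x z ?k m] 1 k(1) assms by (simp add: insert_commute)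
  qed (use assms in auto)
  ultimately show ?thesis using m by blast
qed

definition meet :: "'a \<Rightarrow> 'a \<Rightarrow> 'a" where
  "meet x z = (SOME m. anc m x \<and> anc m z \<and> d x z = d x m + d m z)"

lemma meet:
  assumes "x \<in> V" "z \<in> V"
  shows "anc (meet x z) x" "anc (meet x z) z"
    "d x z + 2 * dep (meet x z) = dep x + dep z"
proof -
  have *: "anc (meet x z) x \<and> anc (meet x z) z \<and> d x z = d x (meet x z) + d (meet x z) z"
    unfolding meet_def by (rule someI_ex[OF meet_ex[OF assms]])
  then show "anc (meet x z) x" "anc (meet x z) z" by auto
  have "d x (meet x z) = d (meet x z) x" using * anc_V[of _ x] d_sym[OF assms(1)] by blast
  then show "d x z + 2 * dep (meet x z) = dep x + dep z" using * unfolding anc_def by auto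
qed

lemma meet_greatest:
  assumes "anc w x" "anc w z"
  shows "anc w (meet x z)"
proof -
  have V: "w \<in> V" "x \<in> V" "z \<in> V" using assms anc_V by auto
  have "d x z \<le> d x w + d w z" using d_triangle[of x w z] V by auto
  moreover have "dep x = dep w + d x w" "dep z = dep w + d w z"
    using assms d_sym[of w x] V unfolding anc_def by auto
  ultimately have "dep w \<le> dep (meet x z)" using meet(3)[OF V(2,3)] by linarith
  then show ?thesis using anc_chain[OF assms(1) meet(1)] V by simp
qed

lemma meet_anc: "anc w x \<Longrightarrow> meet w x = w"
  using anc_eq[OF meet(1)] meet_greatest[OF anc_refl] anc_dep anc_V by metis

text \<open>Turns the length of a climb into a number of vertices: each level in between holds an
  ancestor of \<open>v\<close>.\<close>

lemma dep_diff_le_card: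
  assumes "anc w v" "finite X" "\<And>y. anc y v \<Longrightarrow> dep w < dep y \<Longrightarrow> y \<in> X"
  shows "dep v \<le> dep w + card X"
proof -
  have "{dep w<..dep v} \<subseteq> dep ` X"
  proof
    fix k assume k: "k \<in> {dep w<..dep v}"
    then obtain y where "anc y v" "dep y = k" using anc_at[of v k] anc_V assms(1) by auto
    then show "k \<in> dep ` X" using assms(3) k by auto
  qed
  from card_mono[OF _ this] have "dep v - dep w \<le> card (dep ` X)" using assms by simp
  then show ?thesis using card_image_le[OF assms(2), of dep] by linarith
qed

text \<open>A meet deeper than \<open>q\<close> would put \<open>q\<close> strictly above
  \<open>v\<close>; otherwise the meet is above \<open>q\<close> and hence common to all targets
  below \<open>q\<close>.\<close>

lemma meet_dep_outside:
  assumes "anc q x" "anc q y" "v \<in> V" "\<not> anc q v \<or> v = q"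
  shows "dep (meet v x) = dep (meet v y)"
proof -
  have "dep (meet v x) \<le> dep (meet v y)" if "anc q x" "anc q y" for x y
  proof -
    have w: "anc (meet v x) v" "anc (meet v x) x" using meet assms that anc_V by auto
    have "dep (meet v x) \<le> dep q"
    proof (rule ccontr)
      assume "\<not> dep (meet v x) \<le> dep q"
      then have "anc q (meet v x)" using anc_chain[OF that(1) w(2)] by simp
      then have "v = q" using anc_trans w assms(4) by blast
      then show False using anc_dep[OF w(1)] \<open>\<not> dep (meet v x) \<le> dep q\<close> by simp
    qed
    then have "anc (meet v x) y" using anc_chain[OF w(2) that(1)] anc_trans that by blast
    then show ?thesis using meet_greatest w anc_dep by blast
  qed
  from this[OF assms(1,2)] this[OF assms(2,1)] show ?thesis by simp
qed

end

lemma (in tree) rooted_treeI: "c \<in> V \<Longrightarrow> rooted_tree V E c"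
  by unfold_locales

section \<open>Predictions seen from a hypothetical goal\<close>

text \<open>The hypothesis is that the goal lies at distance \<open>D\<close> from \<open>c\<close>, in the branch of a vertex
  \<open>b\<close>. It is tested on families (a vertex with its children) rather than on vertices: a family
  is never right for two hypotheses that leave it through different children, while every
  vertex lies in only two families.\<close>

locale hypotheses = rooted_tree +
  fixes f :: "'a \<Rightarrow> int" and D :: int
begin

definition family :: "'a \<Rightarrow> 'a set" where
  "family u = {v. v = u \<or> {u, v} \<in> E \<and> dep v = Suc (dep u)}"

text \<open>A goal at distance \<open>D\<close> from \<open>c\<close> inside the branch of
  \<open>b\<close> is \<open>D - dep b\<close> away from \<open>b\<close>, and from outside the
  branch it is reached through \<open>b\<close>; this gives the predicted value.\<close>

definition right :: "'a \<Rightarrow> 'a \<Rightarrow> bool" where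
  "right u b \<longleftrightarrow> (\<forall>v\<in>family u. f v = int (d v b) + D - int (dep b))"

lemma family_V: "u \<in> V \<Longrightarrow> family u \<subseteq> V"
  unfolding family_def using adj_V by auto

text \<open>In terms of meets, a prediction states at which depth the path to the goal leaves the
  path from \<open>c\<close> to \<open>v\<close>. As ancestors of \<open>v\<close> are determined by
  their depth, the value \<open>f v\<close> names at most one ancestor of \<open>v\<close>.\<close>

lemma prediction_iff:
  assumes "v \<in> V" "b \<in> V"
  shows "f v = int (d v b) + D - int (dep b) \<longleftrightarrow> f v + 2 * int (dep (meet v b)) = D + int (dep v)"
  using meet(3)[OF assms] by linarith

lemma right_iff:
  assumes "u \<in> V" "b \<in> V"
  shows "right u b \<longleftrightarrow> (\<forall>v\<in>family u. f v + 2 * int (dep (meet v b)) = D + int (dep v))"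
  unfolding right_def using prediction_iff family_V[OF assms(1)] assms(2) by auto

lemma right_self:
  assumes "u \<in> V" "b \<in> V" "right u b"
  shows "f u + 2 * int (dep (meet u b)) = D + int (dep u)"
proof -
  have "u \<in> family u" unfolding family_def by simp
  then show ?thesis using right_iff[OF assms(1,2)] assms(3) by blast
qed

text \<open>A family rooted outside the branch of \<open>q\<close> meets that branch at most in
  \<open>q\<close> itself, and from there all targets below \<open>q\<close> have meets of the same
  depth.\<close>

lemma right_outside:
  assumes "anc q x" "anc q y" "u \<in> V" "\<not> anc q u"
  shows "right u x \<longleftrightarrow> right u y"
proof -
  have "dep (meet v x) = dep (meet v y)" if v: "v \<in> family u" for v
  proof (rule meet_dep_outside[OF assms(1,2)])
    show "v \<in> V" using v family_V assms by auto
    show "\<not> anc q v \<or> v = q"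
      using v assms(4) anc_parent[of u v q] unfolding family_def by auto
  qed
  then show ?thesis using right_iff[OF assms(3)] assms(1,2) anc_V by simp
qed

text \<open>From outside the two branches at \<open>m\<close> both targets have the same meet, no
  deeper than \<open>m\<close>. Only the family of \<open>m\<close> reaches into a branch from
  outside, which is why \<open>u\<close> differs from \<open>m\<close>.\<close>

lemma right_fork:
  assumes "anc m x" "anc m z" "m \<noteq> x" "m \<noteq> z" "u \<in> V" "u \<noteq> m"
    "\<not> anc (toward m x) u" "\<not> anc (toward m z) u"
  shows "right u x \<longleftrightarrow> right u z"
proof -
  have le: "dep (meet v x) \<le> dep (meet v z)"
    if "anc m x" "anc m z" "m \<noteq> x" "v \<in> V" "\<not> anc (toward m x) v" for v x z
  proof -
    have w: "anc (meet v x) v" "anc (meet v x) x" using meet that anc_V by auto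
    note t = toward[OF that(1,3)]
    have "\<not> anc (toward m x) (meet v x)" using that w anc_trans by blast
    then have "dep (meet v x) \<le> dep m" using anc_chain[OF t(3) w(2)] t(2) not_less_eq_eq by metis
    then have "anc (meet v x) z" using anc_chain[OF w(2) that(1)] that anc_trans by blast
    then show ?thesis using meet_greatest w anc_dep by blast
  qed
  have "dep (meet v x) = dep (meet v z)" if v: "v \<in> family u" for v
  proof -
    have "\<not> anc (toward m y) v" if y: "anc m y" "m \<noteq> y" "\<not> anc (toward m y) u" for y
    proof
      assume a: "anc (toward m y) v"
      have "v \<noteq> u" using a y by auto
      then have e: "{u, v} \<in> E" "dep v = Suc (dep u)" using v unfolding family_def by auto
      then have "toward m y = v" using anc_parent[OF e a] y(3) by blast
      then have "u = m" using parent_unique[OF root e(1) _ e(2)] toward[OF y(1,2)] by blast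
      then show False using assms by simp
    qed
    then have "\<not> anc (toward m x) v" "\<not> anc (toward m z) v" using assms by auto
    moreover have "v \<in> V" using v family_V[OF assms(5)] by auto
    ultimately show ?thesis using le[of x z v] le[of z x v] assms by simp
  qed
  then show ?thesis using right_iff[OF assms(5)] assms(1,2) anc_V by simp
qed

text \<open>The family of \<open>m\<close> contains the child towards \<open>x\<close>. Being right
  for both targets would make this child meet \<open>x\<close> and \<open>z\<close> equally deep,
  hence lie above \<open>z\<close> although it is below the meet \<open>m\<close>. The prediction of
  \<open>m\<close> alone could not tell the two apart.\<close>

lemma right_at_fork:
  assumes "m = meet x z" "x \<in> V" "z \<in> V" "m \<noteq> x" "right m x"
  shows "\<not> right m z"
proof
  assume r: "right m z"
  have m: "anc m x" "anc m z" using meet assms by auto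
  let ?k = "toward m x"
  note k = toward[OF m(1) assms(4)]
  have "?k \<in> family m" using k unfolding family_def by auto
  then have "dep (meet ?k x) = dep (meet ?k z)" using r assms(5) right_iff m anc_V by fastforce
  moreover have "meet ?k x = ?k" using k meet_anc by auto
  moreover have "anc (meet ?k z) ?k" "anc (meet ?k z) z" using meet k m anc_V by auto
  ultimately have "anc ?k z" using anc_unique[of "meet ?k z" ?k ?k] k anc_V anc_refl by metis
  then have "anc ?k m" using meet_greatest k assms by auto
  then show False using anc_dep k by fastforce
qed

lemma meet_branch:
  assumes "m = meet x z" "x \<in> V" "z \<in> V" "m \<noteq> x" "anc (toward m x) u"
  shows "meet u z = m"
proof -
  have m: "anc m x" "anc m z" using meet assms by auto
  note k = toward[OF m(1) assms(4)]
  have uV: "u \<in> V" using assms anc_V by auto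
  have w: "anc (meet u z) u" "anc (meet u z) z" using meet uV assms by auto
  have "anc m u" using k(4) assms(5) anc_trans by blast
  then have "anc m (meet u z)" using m meet_greatest by blast
  moreover have "dep (meet u z) \<le> dep m"
  proof (rule ccontr)
    assume "\<not> dep (meet u z) \<le> dep m"
    then have "anc (toward m x) (meet u z)" using anc_chain[OF assms(5) w(1)] k by auto
    then have "anc (toward m x) z" using w anc_trans by blast
    then have "anc (toward m x) m" using meet_greatest k assms by auto
    then show False using anc_dep k by fastforce
  qed
  ultimately show ?thesis using anc_eq by auto
qed

end

section \<open>Convex sets and forks\<close>

context tree
begin

text \<open>Convexity, which in a tree amounts to connectedness. In this form, paths between visited
  vertices stay inside \<open>S\<close>, and so do ancestors when the root is visited.\<close>

definition geod_closed :: "'a set \<Rightarrow> bool" where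
  "geod_closed S \<longleftrightarrow> S \<subseteq> V \<and> (\<forall>u\<in>S. \<forall>v\<in>S. \<forall>w\<in>V. d u v = d u w + d w v \<longrightarrow> w \<in> S)"

lemma geod_closed_sing:
  assumes "r \<in> V"
  shows "geod_closed {r}"
proof -
  have "w = r" if "w \<in> V" "d r r = d r w + d w r" for w
    using d_0[OF assms that(1)] that(2) assms by simp
  then show ?thesis unfolding geod_closed_def using assms by blast
qed

lemma d_adj:
  assumes "{u, v} \<in> E"
  shows "d u v = 1"
proof -
  have V: "u \<in> V" "v \<in> V" "u \<noteq> v" using adj_V[OF assms] by blast+
  have "d u v \<le> Suc 0" using d_adj_le[OF V(1) assms] V by simp
  then show ?thesis using d_0[OF V(1,2)] V(3) by linarith
qed

text \<open>Otherwise \<open>x\<close> would lie on the path from \<open>u\<close> to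
  \<open>y\<close> and belong to \<open>S\<close>.\<close>

lemma boundary_further:
  assumes "geod_closed S" "x \<in> V" "x \<notin> S" "y \<in> S" "{y, x} \<in> E" "u \<in> S"
  shows "d u x = Suc (d u y)"
proof -
  have V: "u \<in> V" "y \<in> V" using assms unfolding geod_closed_def by blast+
  have "{x, y} \<in> E" using assms(5) by (simp add: insert_commute)
  then have "d x y = 1" by (rule d_adj)
  then have "d u y \<noteq> Suc (d u x)" using assms(1-4,6) unfolding geod_closed_def by (metis Suc_eq_plus1)
  then show ?thesis using adj_d_cases[OF V(1) assms(5)] by blast
qed

lemma geod_closed_insert:
  assumes "geod_closed S" "x \<in> boundary V E S"
  shows "geod_closed (insert x S)"
proof -
  have SV: "S \<subseteq> V" using assms unfolding geod_closed_def by blast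
  obtain y where x: "x \<in> V" "x \<notin> S" and y: "y \<in> S" "{y, x} \<in> E"
    using assms unfolding boundary_def by blast
  have one: "w \<in> insert x S" if H: "u \<in> S" "w \<in> V" "d u x = d u w + d w x" for u w
  proof (cases "w = x")
    case False
    have uV: "u \<in> V" using H SV by blast
    interpret U: rooted_tree V E u using rooted_treeI[OF uV] .
    have "U.anc w x" unfolding U.anc_def using H x by blast
    then have "U.anc w y" using U.anc_parent[OF y(2)] boundary_further[OF assms(1) x y H(1)] False by blast
    then have "d u y = d u w + d w y" unfolding U.anc_def by blast
    then show ?thesis using assms(1) H y unfolding geod_closed_def by blast
  qed simp
  have two: "w \<in> insert x S" if H: "u \<in> S" "w \<in> V" "d x u = d x w + d w u" for u w
  proof -
    have uV: "u \<in> V" using H SV by blast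
    have "d u x = d u w + d w x"
      using H d_sym[OF x(1) uV] d_sym[OF x(1) H(2)] d_sym[OF uV H(2)] by simp
    then show ?thesis using one H by blast
  qed
  have three: "w \<in> insert x S" if "w \<in> V" "d x x = d x w + d w x" for w
    using d_0[OF x(1) that(1)] that x by simp
  show ?thesis unfolding geod_closed_def
  proof (intro conjI ballI impI)
    show "insert x S \<subseteq> V" using SV x by blast
    fix u v w assume uv: "u \<in> insert x S" "v \<in> insert x S" and w: "w \<in> V" "d u v = d u w + d w v"
    show "w \<in> insert x S"
    proof (cases "u = x"; cases "v = x")
      assume "u \<noteq> x" "v \<noteq> x"
      then have "w \<in> S" using uv w assms(1) unfolding geod_closed_def by blast
      then show ?thesis by simp
    qed (use one two three uv w in blast)+
  qed
qed

end

section \<open>Boundary vertices as roots of the unexplored branches\<close>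

context rooted_tree
begin

lemma anc_in:
  assumes "geod_closed S" "c \<in> S" "u \<in> S" "anc w u"
  shows "w \<in> S"
proof -
  have "w \<in> V" "d c u = d c w + d w u" using assms(4) unfolding anc_def by blast+
  then show ?thesis using assms(1-3) unfolding geod_closed_def by blast
qed

lemma bd_proper:
  assumes "geod_closed S" "c \<in> S" "b \<in> boundary V E S" "anc w b" "w \<noteq> b"
  shows "w \<in> S"
proof -
  obtain y where b: "b \<in> V" "b \<notin> S" and y: "y \<in> S" "{y, b} \<in> E"
    using assms(3) unfolding boundary_def by blast
  have "dep b = Suc (dep y)" using boundary_further[OF assms(1) b y assms(2)] .
  then have "anc w y" using anc_parent[OF y(2)] assms by blast
  then show ?thesis using anc_in assms y by blast
qed

text \<open>The witness is the highest ancestor of \<open>z\<close> outside \<open>S\<close>; its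
  parent is visited.\<close>

lemma bd_anc_ex:
  assumes "geod_closed S" "c \<in> S" "z \<in> V" "z \<notin> S"
  shows "\<exists>b\<in>boundary V E S. anc b z"
proof -
  define b where "b = arg_min dep (\<lambda>w. anc w z \<and> w \<notin> S)"
  have b: "anc b z" "b \<notin> S"
    unfolding b_def using arg_min_natI[of "\<lambda>w. anc w z \<and> w \<notin> S" z dep] anc_refl assms by auto
  have min: "dep b \<le> dep w" if "anc w z" "w \<notin> S" for w
    unfolding b_def using arg_min_nat_le[of "\<lambda>w. anc w z \<and> w \<notin> S" w dep] that by blast
  have bV: "b \<in> V" using b anc_V by blast
  have "c \<noteq> b" using b assms by blast
  then obtain p where p: "{p, b} \<in> E" "dep b = Suc (dep p)"
    by (rule parent_ex[OF anc_root[OF bV]])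
  have "anc p z" using anc_trans[OF anc_adj[OF p] b(1)] .
  then have "p \<in> S" using min[of p] p by fastforce
  then show ?thesis using p b bV unfolding boundary_def by blast
qed

lemma in_anc_bd:
  assumes "geod_closed S" "c \<in> S" "w \<in> S" "b \<notin> S" "anc w z" "anc b z"
  shows "anc w b" "w \<noteq> b"
proof -
  have "\<not> dep b \<le> dep w"
    using anc_chain[OF assms(6,5)] anc_in[OF assms(1,2,3), of b] assms(4) by blast
  then show "anc w b" using anc_chain[OF assms(5,6)] by simp
  show "w \<noteq> b" using assms by blast
qed

lemma branch_off:
  assumes "x \<in> V" "z \<in> V" "meet x z \<noteq> x"
  shows "\<not> anc (toward (meet x z) x) z"
proof
  note k = toward[OF meet(1)[OF assms(1,2)] assms(3)]
  assume "anc (toward (meet x z) x) z"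
  then have "anc (toward (meet x z) x) (meet x z)" using meet_greatest k by blast
  then show False using anc_dep[of "toward (meet x z) x" "meet x z"] k(2) by simp
qed

lemma d_le_via:
  assumes "anc q p" "anc q y"
  shows "d p y + 2 * dep q \<le> dep p + dep y"
proof -
  have V: "q \<in> V" "p \<in> V" "y \<in> V" using assms anc_V by blast+
  have "d p y \<le> d p q + d q y" using d_triangle[OF V(2,1,3)] .
  moreover have "dep p = dep q + d p q" "dep y = dep q + d q y"
    using assms d_sym[OF V(1,2)] unfolding anc_def by simp_all
  ultimately show ?thesis by linarith
qed

end

section \<open>Mistakes of hypotheses on the visited set\<close>

context hypotheses
begin

definition err :: "'a set \<Rightarrow> 'a \<Rightarrow> nat" where
  "err S b = card {u \<in> S. \<not> right u b}"

lemma right_bd: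
  assumes "geod_closed S" "c \<in> S" "b \<notin> S" "anc b z" "u \<in> S"
  shows "right u b \<longleftrightarrow> right u z"
proof (rule right_outside)
  show "anc b b" using anc_refl anc_V assms(4) by blast
  show "u \<in> V" using assms unfolding geod_closed_def by blast
  show "\<not> anc b u" using anc_in[OF assms(1,2,5)] assms(3) by blast
qed (rule assms)

text \<open>No visited vertex lies below an unvisited \<open>b\<close>, so no visited family
  distinguishes \<open>b\<close> from a vertex \<open>z\<close> below it. Thus a deep vertex can
  stand in for the boundary vertex above it.\<close>

lemma err_anc:
  assumes "geod_closed S" "c \<in> S" "b \<notin> S" "anc b z"
  shows "err S b = err S z"
proof -
  have "{u \<in> S. \<not> right u b} = {u \<in> S. \<not> right u z}" using right_bd[OF assms] by blast
  then show ?thesis unfolding err_def by simp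
qed

lemma err_mono:
  assumes "S \<subseteq> T" "T \<subseteq> V"
  shows "err S b \<le> err T b"
  unfolding err_def
proof (rule card_mono)
  show "finite {u \<in> T. \<not> right u b}" using finite_subset[OF assms(2) finite_V] by simp
  show "{u \<in> S. \<not> right u b} \<subseteq> {u \<in> T. \<not> right u b}" using assms(1) by blast
qed

definition plausible :: "nat \<Rightarrow> 'a set \<Rightarrow> 'a set" where
  "plausible \<beta> S = {b \<in> boundary V E S. err S b \<le> \<beta>}"

text \<open>The families that are wrong for \<open>z\<close> but right for a branch forking off at \<open>m\<close> have
  predictions that name the depth of \<open>m\<close>, so they are charged by one vertex \<open>m\<close> only.\<close>

definition fork_voters :: "'a set \<Rightarrow> 'a \<Rightarrow> 'a set" where
  "fork_voters F m = {u \<in> F. anc m u \<and> f u + 2 * int (dep m) = D + int (dep u)}"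

text \<open>Compares the mistakes of \<open>x\<close> with the mistakes \<open>F\<close> of
  \<open>z\<close>. Inside the branch \<open>k\<close> a family right for \<open>z\<close> names
  \<open>m\<close> and is wrong for \<open>x\<close>; the family of \<open>m\<close> is wrong for
  one of the two. A family wrong for \<open>z\<close> but right for \<open>x\<close>, outside the
  branch and not at \<open>m\<close>, is a fork voter.\<close>

lemma err_fork:
  assumes S: "geod_closed S" "c \<in> S" and x: "x \<in> boundary V E S" and z: "z \<in> V"
    and off: "\<not> anc x z" and m_def: "m = meet x z" and k_def: "k = toward m x"
    and F_def: "F = {u \<in> S. \<not> right u z}" and mz: "m \<noteq> z"
  shows "card F + card {u \<in> S. anc k u} + 1
    \<le> err S x + 2 * card {u \<in> F. anc k u} + card (fork_voters F m) + 2 * (if m \<in> F then 1 else 0)"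
proof -
  have SV: "S \<subseteq> V" using S(1) unfolding geod_closed_def by blast
  have finS: "finite S" using finite_subset[OF SV finite_V] .
  then have finF: "finite F" unfolding F_def by simp
  have xV: "x \<in> V" using x unfolding boundary_def by blast
  have m: "anc m x" "anc m z" using meet[OF xV z] m_def by simp_all
  have mx: "m \<noteq> x" using m off by blast
  have mS: "m \<in> S" using bd_proper[OF S x m(1) mx] .
  note k = toward[OF m(1) mx, folded k_def]
  define Wx where "Wx = {u \<in> S. \<not> right u x}"
  define Q where "Q = {u \<in> S. anc k u}"
  define FQ where "FQ = {u \<in> F. anc k u}"
  define R where "R = {u \<in> F \<inter> Wx. \<not> anc k u \<and> u \<noteq> m}"
  define Fm where "Fm = F \<inter> {m}"
  have nk: "\<not> anc k m" using anc_dep[of k m] k(2) by auto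
  \<comment> \<open>By \<open>right_fork\<close> such a family lies in the branch of
    \<open>z\<close>, from which \<open>x\<close> is seen through \<open>m\<close>; being right for
    \<open>x\<close> it names \<open>m\<close>.\<close>
  have A: "u \<in> fork_voters F m" if u: "u \<in> F" "\<not> anc k u" "u \<noteq> m" "u \<notin> Wx" for u
  proof -
    have uS: "u \<in> S" "\<not> right u z" "right u x" using u unfolding F_def Wx_def by auto
    then have uV: "u \<in> V" using SV by blast
    have kz: "anc (toward m z) u"
      using right_fork[OF m mx mz uV u(3)] u(2) uS k_def by blast
    have "meet x z = meet z x"
    proof -
      have "anc (meet x z) (meet z x)" "anc (meet z x) (meet x z)"
        using meet_greatest meet[OF xV z] meet[OF z xV] by blast+
      then show ?thesis using anc_eq anc_dep by blast
    qed
    then have "meet u x = m" using meet_branch[of m z x u] m_def z xV mz kz by simp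
    then have "f u + 2 * int (dep m) = D + int (dep u)"
      using right_self[OF uV xV uS(3)] by simp
    moreover have "anc m u" using toward(4)[OF m(2) mz] kz anc_trans by blast
    ultimately show ?thesis using u(1) unfolding fork_voters_def by blast
  qed
  have "F \<subseteq> FQ \<union> Fm \<union> fork_voters F m \<union> R"
    using A unfolding FQ_def Fm_def R_def by blast
  moreover have "finite (FQ \<union> Fm \<union> fork_voters F m \<union> R)"
    using finF unfolding FQ_def Fm_def R_def fork_voters_def by simp
  ultimately have "card F \<le> card (FQ \<union> Fm \<union> fork_voters F m \<union> R)" by (rule card_mono[rotated])
  also have "\<dots> \<le> card FQ + card Fm + card (fork_voters F m) + card R"
    by (meson add_le_mono1 card_Un_le le_trans)
  finally have c1: "card F \<le> card FQ + card Fm + card (fork_voters F m) + card R" .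
  have QW: "u \<in> Wx" if u: "u \<in> Q" "u \<notin> FQ" for u
  proof -
    have uS: "u \<in> S" "anc k u" using u unfolding Q_def by auto
    then have uz: "right u z" using u unfolding FQ_def F_def by blast
    have uV: "u \<in> V" using uS SV by blast
    have mz': "meet u z = m" using meet_branch[OF m_def xV z mx] uS(2) k_def by blast
    have "anc k (meet u x)" using meet_greatest[OF uS(2) k(3)] .
    then have "dep (meet u x) \<noteq> dep m" using anc_dep[of k "meet u x"] k(2) by simp
    then have "\<not> right u x" using right_self[OF uV z uz] right_self[OF uV xV] mz' by auto
    then show ?thesis using uS unfolding Wx_def by blast
  qed
  have mW: "m \<in> Wx" if "m \<notin> F"
  proof -
    have "right m z" using that mS unfolding F_def by blast
    then have "\<not> right m x" using right_at_fork[OF m_def xV z mx] by blast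
    then show ?thesis using mS unfolding Wx_def by blast
  qed
  have sub: "(Q - FQ) \<union> ({m} - F) \<union> R \<subseteq> Wx" using QW mW unfolding R_def by blast
  have finQ: "finite Q" "finite R" "finite FQ" using finS finF unfolding Q_def R_def FQ_def by simp_all
  have "card ((Q - FQ) \<union> ({m} - F) \<union> R) = card ((Q - FQ) \<union> ({m} - F)) + card R"
    using finQ nk unfolding Q_def R_def by (intro card_Un_disjoint) auto
  also have "card ((Q - FQ) \<union> ({m} - F)) = card (Q - FQ) + card ({m} - F)"
    using finQ nk unfolding Q_def by (intro card_Un_disjoint) auto
  also have "card (Q - FQ) = card Q - card FQ"
    using finQ unfolding FQ_def F_def Q_def by (intro card_Diff_subset) auto
  finally have "card Q - card FQ + card ({m} - F) + card R \<le> card Wx"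
    using card_mono[OF _ sub] finS unfolding Wx_def by simp
  \<comment> \<open>If the family of \<open>m\<close> is not in \<open>F\<close>, it is a mistake of
    \<open>x\<close>. Substituting \<open>1 - card Fm\<close> for the second indicator produces the
    \<open>+ 1\<close> and the doubled last term.\<close>
  moreover have "card Fm + card ({m} - F) = 1 \<and> card Fm = (if m \<in> F then 1 else 0)"
  proof (cases "m \<in> F")
    case True
    then have "Fm = {m}" "{m} - F = {}" unfolding Fm_def by blast+
    then show ?thesis using True by simp
  next
    case False
    then have "Fm = {}" "{m} - F = {m}" unfolding Fm_def by blast+
    then show ?thesis using False by simp
  qed
  ultimately show ?thesis using c1 unfolding err_def Wx_def[symmetric] Q_def[symmetric] FQ_def[symmetric]
    by linarith
qed

text \<open>Preferring \<open>x\<close> to \<open>b\<close> saves at most as many upward steps as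
  the branch has visited vertices, weighted by two. By \<open>err_fork\<close> these vertices also
  count as mistakes of \<open>x\<close>, weighted by four, up to corrections from \<open>F\<close>.
  The surplus bounds the size of the branch by the corrections.\<close>

lemma branch_size:
  assumes S: "geod_closed S" "c \<in> S" and x: "x \<in> boundary V E S" and z: "z \<in> V" "z \<notin> S"
    and off: "\<not> anc x z" and b: "b \<notin> S" "anc b z" and p: "p \<in> S"
    and rule: "4 * err S x + d p x + dep b \<le> 4 * err S b + d p b + dep x"
    and m_def: "m = meet x z" and k_def: "k = toward m x"
    and F_def: "F = {u \<in> S. \<not> right u z}"
  shows "card {u \<in> S. anc k u} + 2
    \<le> 4 * card {u \<in> F. anc k u} + 2 * card (fork_voters F m) + 4 * (if m \<in> F then 1 else 0)"
proof -
  have SV: "S \<subseteq> V" using S(1) unfolding geod_closed_def by blast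
  have finS: "finite S" using finite_subset[OF SV finite_V] .
  have V: "x \<in> V" "x \<notin> S" "b \<in> V" "p \<in> V" using x b anc_V p SV unfolding boundary_def by blast+
  have m: "anc m x" "anc m z" using meet[OF V(1) z(1)] m_def by simp_all
  have mx: "m \<noteq> x" using m off by blast
  have mS: "m \<in> S" using bd_proper[OF S x m(1) mx] .
  have mz: "m \<noteq> z" using mS z by blast
  note k = toward[OF m(1) mx, folded k_def]
  have mb: "anc m b" using in_anc_bd(1)[OF S mS b(1) m(2) b(2)] .
  have errb: "err S b = card F" using err_anc[OF S b] unfolding err_def F_def by simp
  have w: "anc (meet p x) p" "anc (meet p x) x" using meet V by simp_all
  have wS: "meet p x \<in> S" using anc_in[OF S p w(1)] .
  \<comment> \<open>If the climb towards \<open>x\<close> ends inside the branch, all levels between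
    \<open>m\<close> and its end hold visited vertices of the branch. If it ends outside, its end is
    above \<open>b\<close> as well.\<close>
  have "dep (meet p x) \<le> dep (meet p b) + card {u \<in> S. anc k u}"
  proof (cases "anc k (meet p x)")
    case True
    have mw: "anc m (meet p x)" using anc_trans[OF k(4) True] .
    have "dep (meet p x) \<le> dep m + card {u \<in> S. anc k u}"
    proof (rule dep_diff_le_card[OF mw])
      show "finite {u \<in> S. anc k u}" using finS by simp
      fix y assume y: "anc y (meet p x)" "dep m < dep y"
      have "anc k y" using anc_chain[OF k(3) anc_trans[OF y(1) w(2)]] k(2) y(2) by simp
      then show "y \<in> {u \<in> S. anc k u}" using anc_in[OF S wS y(1)] by simp
    qed
    moreover have "dep m \<le> dep (meet p b)"
      using anc_dep[OF meet_greatest[OF anc_trans[OF mw w(1)] mb]] .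
    ultimately show ?thesis by linarith
  next
    case False
    then have "dep (meet p x) \<le> dep m" using anc_chain[OF k(3) w(2)] k(2) not_less_eq_eq by metis
    then have "anc (meet p x) b" using anc_trans[OF anc_chain[OF w(2) m(1)] mb] by blast
    then have "dep (meet p x) \<le> dep (meet p b)" using anc_dep[OF meet_greatest[OF w(1)]] by blast
    then show ?thesis by linarith
  qed
  then show ?thesis
    using err_fork[OF S x z(1) off m_def k_def F_def mz] rule errb meet(3)[OF V(4,1)] meet(3)[OF V(4,3)]
    by linarith
qed

end

section \<open>Runs with a fixed root and a fixed guess\<close>

lemma double_count:
  assumes "finite C" "finite F" "\<And>k. k \<in> C \<Longrightarrow> G k \<subseteq> F" "\<And>u. u \<in> F \<Longrightarrow> card {k \<in> C. u \<in> G k} \<le> n"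
  shows "(\<Sum>k\<in>C. card (G k)) \<le> n * card F"
proof -
  have "(\<Sum>k\<in>C. card (G k)) = (\<Sum>k\<in>C. \<Sum>u\<in>F. if u \<in> G k then 1 else 0)"
  proof (rule sum.cong)
    fix k assume "k \<in> C"
    then have "F \<inter> {u. u \<in> G k} = G k" using assms(3) by blast
    then show "card (G k) = (\<Sum>u\<in>F. if u \<in> G k then 1 else 0)"
      using sum.inter_restrict[OF assms(2), of "\<lambda>_. 1::nat" "{u. u \<in> G k}"] by simp
  qed simp
  also have "\<dots> = (\<Sum>u\<in>F. \<Sum>k\<in>C. if u \<in> G k then 1 else 0)" by (rule sum.swap)
  also have "\<dots> = (\<Sum>u\<in>F. card {k \<in> C. u \<in> G k})"
    using assms(1) by (simp add: sum.If_cases Int_def)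
  also have "\<dots> \<le> (\<Sum>u\<in>F. n)" using assms(4) by (intro sum_mono) simp
  finally show ?thesis by (simp add: mult.commute)
qed

locale run = hypotheses +
  fixes x :: "nat \<Rightarrow> 'a" and S :: "nat \<Rightarrow> 'a set" and a e \<beta> \<Delta> :: nat
  assumes ae: "a \<le> e"
    and start: "geod_closed (S a)" "c \<in> S a" "x a \<in> S a"
    and S_Suc: "\<And>t. a \<le> t \<Longrightarrow> t \<le> e \<Longrightarrow> S (Suc t) = insert (x (Suc t)) (S t)"
    and x_plausible: "\<And>t. a \<le> t \<Longrightarrow> t \<le> e \<Longrightarrow> x (Suc t) \<in> plausible \<beta> (S t)"
    and x_least: "\<And>t y. a \<le> t \<Longrightarrow> t \<le> e \<Longrightarrow> y \<in> plausible \<beta> (S t) \<Longrightarrow>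
      4 * err (S t) (x (Suc t)) + d (x t) (x (Suc t)) + dep y
        \<le> 4 * err (S t) y + d (x t) y + dep (x (Suc t))"
    and degree: "\<And>w. w \<in> V \<Longrightarrow> card {v. {w, v} \<in> E} \<le> \<Delta>"
    and \<Delta>: "1 \<le> \<Delta>"
begin

text \<open>The last vertex chosen in the run plays the goal. It is plausible when chosen, so the
  analysis covers wrong guesses \<open>D\<close> too, and all costs are charged to the families
  \<open>F\<close> that are wrong for \<open>z\<close>.\<close>

definition z :: 'a where "z = x (Suc e)"

definition F :: "'a set" where "F = {u \<in> S e. \<not> right u z}"

lemma x_bd: "a \<le> t \<Longrightarrow> t \<le> e \<Longrightarrow> x (Suc t) \<in> boundary V E (S t)"
  using x_plausible unfolding plausible_def by blast

lemma x_new: "a \<le> t \<Longrightarrow> t \<le> e \<Longrightarrow> x (Suc t) \<in> V \<and> x (Suc t) \<notin> S t"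
  using x_bd unfolding boundary_def by blast

lemma S_props:
  assumes "a \<le> t" "t \<le> Suc e"
  shows "geod_closed (S t) \<and> c \<in> S t \<and> x t \<in> S t"
  using assms
proof (induction t rule: dec_induct)
  case base
  then show ?case using start by blast
next
  case (step t)
  then have t: "a \<le> t" "t \<le> e" by auto
  have "geod_closed (S (Suc t))"
    using geod_closed_insert[OF _ x_bd[OF t]] step S_Suc[OF t] by auto
  then show ?case using step S_Suc[OF t] by auto
qed

lemma S_closed: "a \<le> t \<Longrightarrow> t \<le> Suc e \<Longrightarrow> geod_closed (S t)"
  and c_in: "a \<le> t \<Longrightarrow> t \<le> Suc e \<Longrightarrow> c \<in> S t"
  and x_in: "a \<le> t \<Longrightarrow> t \<le> Suc e \<Longrightarrow> x t \<in> S t"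
  using S_props by blast+

lemma S_V: "a \<le> t \<Longrightarrow> t \<le> Suc e \<Longrightarrow> S t \<subseteq> V"
  using S_closed unfolding geod_closed_def by blast

lemma S_fin: "a \<le> t \<Longrightarrow> t \<le> Suc e \<Longrightarrow> finite (S t)"
  using S_V finite_V finite_subset by blast

lemma S_mono:
  assumes "a \<le> s" "s \<le> t" "t \<le> Suc e"
  shows "S s \<subseteq> S t"
  using assms(2,1,3)
proof (induction t rule: dec_induct)
  case (step t)
  then show ?case using S_Suc[of t] by auto
qed simp

lemma x_fresh:
  assumes "a \<le> s" "s < t" "t \<le> Suc e"
  shows "x t \<notin> S s"
proof -
  obtain t' where t': "t = Suc t'" using assms by (cases t) auto
  then have "x t \<notin> S t'" using x_new[of t'] assms by simp
  then show ?thesis using S_mono[of s t'] assms t' by auto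
qed

lemma x_inj:
  assumes "a \<le> s" "s < t" "t \<le> Suc e"
  shows "x s \<noteq> x t"
  using x_fresh[OF assms] x_in[of s] assms by auto

lemma x_V: "a \<le> t \<Longrightarrow> t \<le> Suc e \<Longrightarrow> x t \<in> V"
  using x_in S_V by blast

lemma z_V: "z \<in> V"
  unfolding z_def using x_V ae by simp

lemma z_fresh: "a \<le> t \<Longrightarrow> t \<le> e \<Longrightarrow> z \<notin> S t"
  unfolding z_def using x_fresh by simp

lemma S_from:
  assumes "a \<le> s" "s \<le> t" "t \<le> Suc e" "u \<in> S t" "u \<notin> S s"
  shows "\<exists>r. s < r \<and> r \<le> t \<and> u = x r"
  using assms(2,1,3,4,5)
proof (induction t rule: dec_induct)
  case (step t)
  then have "u = x (Suc t) \<or> u \<in> S t" using S_Suc[of t] by auto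
  then show ?case
  proof
    assume "u = x (Suc t)"
    then show ?thesis using step by (intro exI[of _ "Suc t"]) auto
  next
    assume "u \<in> S t"
    then show ?thesis using step by (meson Suc_leD le_SucI)
  qed
qed blast

text \<open>Mistakes only accumulate: a vertex plausible when it is chosen had, at every earlier
  time of the run, a plausible boundary ancestor.\<close>

lemma plausible_anc:
  assumes "a \<le> t" "t \<le> s" "s \<le> e"
  shows "\<exists>b\<in>plausible \<beta> (S t). anc b (x (Suc s))"
proof -
  have t: "geod_closed (S t)" "c \<in> S t" using S_closed c_in assms by auto
  have y: "x (Suc s) \<in> V" "x (Suc s) \<notin> S t" using x_V x_fresh[of t "Suc s"] assms by auto
  obtain b where b: "b \<in> boundary V E (S t)" "anc b (x (Suc s))" using bd_anc_ex[OF t y] by blast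
  then have "b \<notin> S t" unfolding boundary_def by blast
  then have "err (S t) b = err (S t) (x (Suc s))" using err_anc[OF t _ b(2)] by blast
  also have "\<dots> \<le> err (S s) (x (Suc s))" using err_mono S_mono[of t s] S_V[of s] assms by simp
  also have "\<dots> \<le> \<beta>" using x_plausible[of s] assms unfolding plausible_def by simp
  finally show ?thesis using b unfolding plausible_def by blast
qed

lemma target_anc:
  assumes "a \<le> t" "t \<le> e"
  shows "\<exists>b\<in>plausible \<beta> (S t). anc b z"
  unfolding z_def using plausible_anc[of t e] assms by simp

lemma F_fin: "finite F"
  unfolding F_def using S_fin[of e] ae by simp

lemma F_V: "F \<subseteq> V"
  unfolding F_def using S_V[of e] ae by auto

subsection \<open>Vertices visited off the path\<close>

definition off :: "nat \<Rightarrow> bool" where "off t \<longleftrightarrow> \<not> anc (x t) z"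

definition fork :: "nat \<Rightarrow> 'a" where "fork t = meet (x t) z"

definition branch :: "nat \<Rightarrow> 'a" where "branch t = toward (fork t) (x t)"

definition branches :: "'a set" where "branches = branch ` {t. a < t \<and> t \<le> e \<and> off t}"

definition excess :: "'a set" where "excess = (\<Union>k\<in>branches. {u \<in> S e. anc k u})"

lemma fork:
  assumes "a < t" "t \<le> e" "off t"
  shows "anc (fork t) (x t)" "anc (fork t) z" "fork t \<noteq> x t"
  using meet[of "x t" z] x_V[of t] z_V assms unfolding fork_def off_def by auto

lemma branch:
  assumes "a < t" "t \<le> e" "off t"
  shows "{fork t, branch t} \<in> E" "dep (branch t) = Suc (dep (fork t))" "anc (branch t) (x t)"
    "\<not> anc (branch t) z"
proof -
  have t: "a \<le> t" "t \<le> Suc e" using assms by auto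
  show "{fork t, branch t} \<in> E" "dep (branch t) = Suc (dep (fork t))" "anc (branch t) (x t)"
    unfolding branch_def using toward[OF fork(1,3)[OF assms]] by blast+
  show "\<not> anc (branch t) z"
    unfolding branch_def fork_def using branch_off[OF x_V[OF t] z_V] fork(3)[OF assms]
    unfolding fork_def by blast
qed

lemma branch_same:
  assumes t: "a < t" "t \<le> e" "off t" and s: "a < s" "s \<le> e" and k: "anc (branch t) (x s)"
  shows "off s" "branch s = branch t"
proof -
  show o: "off s" unfolding off_def
    using anc_trans[OF k] branch(4)[OF t] by blast
  have V: "x t \<in> V" using x_V t by simp
  have "fork s = fork t"
    unfolding fork_def
    using meet_branch[OF refl V z_V] fork(3)[OF t] k unfolding branch_def fork_def by blast
  then show "branch s = branch t"
    using anc_unique[OF branch(3)[OF s o] k] branch(2)[OF t] branch(2)[OF s o] by simp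
qed

text \<open>If \<open>k\<close> were strictly above \<open>k'\<close>, it would be above the fork
  from which \<open>k'\<close> leaves, hence above \<open>z\<close>.\<close>

lemma branches_disjoint:
  assumes "k \<in> branches" "k' \<in> branches" "anc k u" "anc k' u"
  shows "k = k'"
proof -
  have le: "k = k'" if k: "k \<in> branches" "k' \<in> branches" "anc k u" "anc k' u" "dep k \<le> dep k'" for k k'
  proof (rule ccontr)
    assume ne: "k \<noteq> k'"
    obtain t where t: "a < t" "t \<le> e" "off t" "k = branch t" using k(1) unfolding branches_def by auto
    obtain s where s: "a < s" "s \<le> e" "off s" "k' = branch s" using k(2) unfolding branches_def by auto
    have "anc k k'" using anc_chain[OF k(3,4,5)] .
    then have "anc k (fork s)" using anc_parent[OF branch(1,2)[OF s(1-3)]] s(4) ne by blast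
    then have "anc k z" using anc_trans fork(2)[OF s(1-3)] by blast
    then show False using branch(4)[OF t(1-3)] t(4) by blast
  qed
  show ?thesis
  proof (cases "dep k \<le> dep k'")
    case True
    then show ?thesis using le assms by blast
  next
    case False
    then have "k' = k" using le[OF assms(2,1,4,3)] by simp
    then show ?thesis by simp
  qed
qed

lemma branches_fin: "finite branches"
proof -
  have "finite {t. a < t \<and> t \<le> e \<and> off t}" by (rule finite_subset[of _ "{..e}"]) auto
  then show ?thesis unfolding branches_def by simp
qed

text \<open>Covers the fork voters of the vertex \<open>m\<close> from which \<open>k\<close>
  leaves. As \<open>u\<close> names only one \<open>m\<close>, it votes for at most as many branches
  as \<open>m\<close> has neighbours.\<close>

definition voters :: "'a \<Rightarrow> 'a set" where
  "voters k = {u \<in> F. \<exists>m. {m, k} \<in> E \<and> anc m u \<and> f u + 2 * int (dep m) = D + int (dep u)}"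

lemma branch_card:
  assumes "k \<in> branches"
  shows "card {u \<in> S e. anc k u}
    \<le> 4 * card {u \<in> F. anc k u} + 2 * card (voters k) + 4 * card {u \<in> F. {u, k} \<in> E}"
proof -
  \<comment> \<open>The last entry into the branch is decisive: \<open>branch_size\<close> applies
    just before it, and it adds only one further vertex to the branch.\<close>
  define T where "T = {t. a < t \<and> t \<le> e \<and> off t \<and> branch t = k}"
  have "finite T" unfolding T_def by (rule finite_subset[of _ "{..e}"]) auto
  moreover have "T \<noteq> {}" using assms unfolding T_def branches_def by auto
  ultimately have "Max T \<in> T" and max: "\<And>s. s \<in> T \<Longrightarrow> s \<le> Max T" by auto
  define s where "s = Max T - 1"
  have "a < Max T" "Max T \<le> e" "off (Max T)" "branch (Max T) = k"
    using \<open>Max T \<in> T\<close> unfolding T_def by blast+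
  moreover from this have "Max T = Suc s" unfolding s_def by simp
  ultimately have s: "Max T = Suc s" "a \<le> s" "Suc s \<le> e" "off (Suc s)" "branch (Suc s) = k"
    by simp_all
  have s': "a < Suc s" "Suc s \<le> e" "off (Suc s)" "s \<le> e" "s \<le> Suc e" using s by auto
  note br = branch[OF s'(1-3), unfolded s(5)]
  obtain b where b: "b \<in> plausible \<beta> (S s)" "anc b z" using target_anc[OF s(2) s'(4)] by blast
  have bS: "b \<notin> S s" using b unfolding plausible_def boundary_def by blast
  define F' where "F' = {u \<in> S s. \<not> right u z}"
  have F'F: "F' \<subseteq> F" unfolding F'_def F_def using S_mono[OF s(2) s'(4)] by auto
  let ?m = "fork (Suc s)"
  have "card {u \<in> S s. anc k u} + 2
    \<le> 4 * card {u \<in> F'. anc k u} + 2 * card (fork_voters F' ?m) + 4 * (if ?m \<in> F' then 1 else 0)"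
  proof (rule branch_size)
    show "x (Suc s) \<in> boundary V E (S s)" using x_bd s by simp
    show "\<not> anc (x (Suc s)) z" using s(4) unfolding off_def .
    show "4 * err (S s) (x (Suc s)) + d (x s) (x (Suc s)) + dep b
        \<le> 4 * err (S s) b + d (x s) b + dep (x (Suc s))" using x_least[OF s(2) s'(4) b(1)] .
    show "k = toward ?m (x (Suc s))" using s(5) unfolding branch_def by simp
    show "z \<notin> S s" using z_fresh s by simp
  qed (use s s' S_closed c_in x_in z_V b bS fork_def F'_def in auto)
  moreover have "card {u \<in> F'. anc k u} \<le> card {u \<in> F. anc k u}"
    using F'F F_fin by (intro card_mono) auto
  moreover have "card (fork_voters F' ?m) \<le> card (voters k)"
  proof (rule card_mono)
    show "finite (voters k)" unfolding voters_def using F_fin by simp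
    show "fork_voters F' ?m \<subseteq> voters k"
      unfolding fork_voters_def voters_def using F'F br(1) by blast
  qed
  moreover have "(if ?m \<in> F' then 1 else 0) \<le> card {u \<in> F. {u, k} \<in> E}"
  proof (cases "?m \<in> F'")
    case True
    then have "{?m} \<subseteq> {u \<in> F. {u, k} \<in> E}" using F'F br(1) by blast
    then have "card {?m} \<le> card {u \<in> F. {u, k} \<in> E}" using F_fin by (intro card_mono) auto
    then show ?thesis by simp
  qed simp
  moreover have "card {u \<in> S e. anc k u} \<le> Suc (card {u \<in> S s. anc k u})"
  proof -
    have "{u \<in> S e. anc k u} \<subseteq> insert (x (Suc s)) {u \<in> S s. anc k u}"
    proof
      fix u assume u: "u \<in> {u \<in> S e. anc k u}"
      show "u \<in> insert (x (Suc s)) {u \<in> S s. anc k u}"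
      proof (cases "u \<in> S s")
        case False
        then obtain r where r: "s < r" "r \<le> e" "u = x r" using S_from[of s e u] u s s' by auto
        have ar: "a < r" using r s by simp
        have "anc (branch (Suc s)) (x r)" using u r s by simp
        then have "r \<in> T" using branch_same[OF s'(1-3) ar r(2)] ar r s unfolding T_def by blast
        then have "r = Suc s" using max[of r] s r by simp
        then show ?thesis using r by simp
      qed (use u in simp)
    qed
    then have "card {u \<in> S e. anc k u} \<le> card (insert (x (Suc s)) {u \<in> S s. anc k u})"
      using S_fin[OF s(2) s'(5)] by (intro card_mono) auto
    also have "\<dots> \<le> Suc (card {u \<in> S s. anc k u})" using card_insert_le_m1 by (simp add: card_insert_if S_fin[OF s(2) s'(5)])
    finally show ?thesis .
  qed
  ultimately show ?thesis by linarith
qed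

lemma neighbours_fin: "finite {v. {w, v} \<in> E}"
  by (rule finite_subset[OF _ finite_V]) (use adj_V in blast)

text \<open>When \<open>branch_card\<close> is summed, a vertex of \<open>F\<close> counts for at
  most one branch as a member, for at most \<open>\<Delta>\<close> as a voter and for at most
  \<open>\<Delta>\<close> as a fork.\<close>

lemma excess_card: "card excess \<le> 10 * \<Delta> * card F"
proof -
  have "card excess \<le> (\<Sum>k\<in>branches. card {u \<in> S e. anc k u})"
    unfolding excess_def by (rule card_UN_le[OF branches_fin])
  also have "\<dots> \<le> (\<Sum>k\<in>branches. 4 * card {u \<in> F. anc k u} + 2 * card (voters k)
      + 4 * card {u \<in> F. {u, k} \<in> E})"
    using branch_card by (intro sum_mono) blast
  also have "\<dots> = 4 * (\<Sum>k\<in>branches. card {u \<in> F. anc k u}) + 2 * (\<Sum>k\<in>branches. card (voters k))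
      + 4 * (\<Sum>k\<in>branches. card {u \<in> F. {u, k} \<in> E})"
    by (simp add: sum.distrib sum_distrib_left)
  also have "(\<Sum>k\<in>branches. card {u \<in> F. anc k u}) \<le> 1 * card F"
  proof (rule double_count[OF branches_fin F_fin])
    fix u assume "u \<in> F"
    have "finite {k \<in> branches. u \<in> {u \<in> F. anc k u}}" using branches_fin by simp
    then have "card {k \<in> branches. u \<in> {u \<in> F. anc k u}} \<le> Suc 0"
      using branches_disjoint by (auto simp: card_le_Suc0_iff_eq)
    then show "card {k \<in> branches. u \<in> {u \<in> F. anc k u}} \<le> 1" by simp
  qed auto
  also have "(\<Sum>k\<in>branches. card (voters k)) \<le> \<Delta> * card F"
  proof (rule double_count[OF branches_fin F_fin])
    fix u assume u: "u \<in> F"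
    show "card {k \<in> branches. u \<in> voters k} \<le> \<Delta>"
    proof (cases "{k \<in> branches. u \<in> voters k} = {}")
      case False
      then obtain m where m: "anc m u" "f u + 2 * int (dep m) = D + int (dep u)"
        unfolding voters_def by blast
      have "{k \<in> branches. u \<in> voters k} \<subseteq> {v. {m, v} \<in> E}"
      proof
        fix k assume "k \<in> {k \<in> branches. u \<in> voters k}"
        then obtain m' where m': "{m', k} \<in> E" "anc m' u" "f u + 2 * int (dep m') = D + int (dep u)"
          unfolding voters_def by blast
        then have "m' = m" using anc_unique[OF m'(2) m(1)] m by linarith
        then show "k \<in> {v. {m, v} \<in> E}" using m' by blast
      qed
      then have "card {k \<in> branches. u \<in> voters k} \<le> card {v. {m, v} \<in> E}"
        by (rule card_mono[OF neighbours_fin])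
      also have "\<dots> \<le> \<Delta>" using degree anc_V[OF m(1)] by blast
      finally show ?thesis .
    next
      case True
      then show ?thesis by (simp only: card.empty)
    qed
  qed (auto simp: voters_def)
  also have "(\<Sum>k\<in>branches. card {u \<in> F. {u, k} \<in> E}) \<le> \<Delta> * card F"
  proof (rule double_count[OF branches_fin F_fin])
    fix u assume u: "u \<in> F"
    have "{k \<in> branches. u \<in> {u \<in> F. {u, k} \<in> E}} \<subseteq> {v. {u, v} \<in> E}" by blast
    then have "card {k \<in> branches. u \<in> {u \<in> F. {u, k} \<in> E}} \<le> card {v. {u, v} \<in> E}"
      by (rule card_mono[OF neighbours_fin])
    also have "\<dots> \<le> \<Delta>" using degree u F_V by blast
    finally show "card {k \<in> branches. u \<in> {u \<in> F. {u, k} \<in> E}} \<le> \<Delta>" .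
  qed blast
  finally have "card excess \<le> 4 * (1 * card F) + 2 * (\<Delta> * card F) + 4 * (\<Delta> * card F)" by simp
  also have "\<dots> \<le> 10 * \<Delta> * card F"
    using mult_le_mono1[OF \<Delta>, of "card F"] by simp
  finally show ?thesis .
qed

lemma off_excess:
  assumes "a < t" "t \<le> e" "off t"
  shows "x t \<in> excess"
proof -
  have "x t \<in> S e" using x_in[of t] S_mono[of t e] assms by auto
  moreover have "branch t \<in> branches" unfolding branches_def using assms by blast
  ultimately show ?thesis unfolding excess_def using branch(3)[OF assms] by blast
qed

lemma excess_fin: "finite excess"
  unfolding excess_def using branches_fin S_fin[of e] ae by simp

subsection \<open>Upward moves\<close>

definition live :: "nat \<Rightarrow> 'a \<Rightarrow> bool" where
  "live t w \<longleftrightarrow> (\<exists>y\<in>plausible \<beta> (S t). anc w y)"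

text \<open>The lowest place at which a climb from \<open>x t\<close> can turn down to a plausible
  hypothesis. It is \<open>x t\<close> itself unless the branch below \<open>x t\<close> is
  exhausted.\<close>

definition turn :: "nat \<Rightarrow> 'a" where
  "turn t = (SOME q. anc q (x t) \<and> live t q \<and> (\<forall>w. anc w (x t) \<and> live t w \<longrightarrow> dep w \<le> dep q))"

lemma turn:
  assumes "a < t" "t \<le> e"
  shows "anc (turn t) (x t)" "live t (turn t)" "\<And>w. anc w (x t) \<Longrightarrow> live t w \<Longrightarrow> dep w \<le> dep (turn t)"
proof -
  let ?P = "\<lambda>w. anc w (x t) \<and> live t w"
  obtain b where "b \<in> plausible \<beta> (S t)" "anc b z" using target_anc[of t] assms by auto
  then have "?P c" using anc_root anc_V x_V[of t] assms unfolding live_def by auto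
  moreover have "\<forall>w. ?P w \<longrightarrow> dep w < Suc (dep (x t))" using anc_dep by fastforce
  ultimately have "\<exists>q. ?P q \<and> (\<forall>w. ?P w \<longrightarrow> dep w \<le> dep q)"
    by (rule ex_has_greatest_nat)
  then have *: "\<exists>q. anc q (x t) \<and> live t q \<and> (\<forall>w. anc w (x t) \<and> live t w \<longrightarrow> dep w \<le> dep q)" by blast
  from someI_ex[OF *, folded turn_def]
  show "anc (turn t) (x t)" "live t (turn t)" "\<And>w. anc w (x t) \<Longrightarrow> live t w \<Longrightarrow> dep w \<le> dep (turn t)" by blast+
qed

text \<open>The hypothesis with which the next choice is compared. If possible it leads to
  \<open>z\<close>, so that its verdicts on visited families agree with those of
  \<open>z\<close>.\<close>

definition rival :: "nat \<Rightarrow> 'a" where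
  "rival t = (SOME y. y \<in> plausible \<beta> (S t) \<and> anc (turn t) y \<and> (anc (turn t) z \<longrightarrow> anc y z))"

lemma rival:
  assumes "a < t" "t \<le> e"
  shows "rival t \<in> plausible \<beta> (S t)" "anc (turn t) (rival t)" "anc (turn t) z \<Longrightarrow> anc (rival t) z"
proof -
  have t: "a \<le> t" "t \<le> Suc e" using assms by auto
  have "\<exists>y. y \<in> plausible \<beta> (S t) \<and> anc (turn t) y \<and> (anc (turn t) z \<longrightarrow> anc y z)"
  proof (cases "anc (turn t) z")
    case True
    obtain b where b: "b \<in> plausible \<beta> (S t)" "anc b z" using target_anc[OF t(1) assms(2)] by blast
    then have "b \<notin> S t" unfolding plausible_def boundary_def by blast
    moreover have "turn t \<in> S t" using anc_in[OF S_closed[OF t] c_in[OF t] x_in[OF t]] turn(1)[OF assms] .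
    ultimately have "anc (turn t) b" using in_anc_bd(1)[OF S_closed[OF t] c_in[OF t]] True b by blast
    then show ?thesis using b by blast
  next
    case False
    then show ?thesis using turn(2)[OF assms] unfolding live_def by blast
  qed
  from someI_ex[OF this, folded rival_def]
  show "rival t \<in> plausible \<beta> (S t)" "anc (turn t) (rival t)" "anc (turn t) z \<Longrightarrow> anc (rival t) z" by blast+
qed

text \<open>The part of the way up from \<open>x t\<close> that has no plausible hypothesis below it
  any more.\<close>

definition dead :: "nat \<Rightarrow> 'a set" where
  "dead t = {w. anc w (x t) \<and> dep (turn t) < dep w}"

text \<open>The families that make the number of mistakes jump when the hypothesis
  \<open>x t\<close> is replaced by the rival.\<close>

definition lost :: "nat \<Rightarrow> 'a set" where
  "lost t = {u \<in> S (t - 1). right u (x t) \<and> \<not> right u (rival t)}"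

lemma dead_not_live: "a < t \<Longrightarrow> t \<le> e \<Longrightarrow> w \<in> dead t \<Longrightarrow> \<not> live t w"
  using turn(3)[of t w] unfolding dead_def by auto

lemma dead_S:
  assumes "a < t" "t \<le> e" "w \<in> dead t"
  shows "w \<in> S t"
  using anc_in[OF S_closed c_in x_in, of t w] assms unfolding dead_def by auto

lemma dead_V: "dead t \<subseteq> V"
  unfolding dead_def using anc_V by blast

lemma dead_fin: "finite (dead t)"
  using finite_subset[OF dead_V finite_V] .

text \<open>Death is permanent: a later visit below \<open>w\<close> would descend from a hypothesis
  that was already plausible at time \<open>t\<close>.\<close>

lemma dead_disjoint:
  assumes "a < t" "t < s" "s \<le> e" "w \<in> dead t" "w \<in> dead s"
  shows False
proof -
  obtain s' where s': "s = Suc s'" using assms by (cases s) auto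
  have t: "a \<le> t" "t \<le> e" "t \<le> Suc e" using assms by auto
  have "t \<le> s'" "s' \<le> e" using assms s' by auto
  then obtain b where b: "b \<in> plausible \<beta> (S t)" "anc b (x s)" using plausible_anc[OF t(1), of s'] s' by blast
  then have "b \<notin> S t" unfolding plausible_def boundary_def by blast
  moreover have "w \<in> S t" using dead_S[OF assms(1) t(2) assms(4)] .
  moreover have "anc w (x s)" using assms(5) unfolding dead_def by blast
  ultimately have "anc w b" using in_anc_bd(1)[OF S_closed[OF t(1,3)] c_in[OF t(1,3)]] b by blast
  then show False using dead_not_live[OF assms(1) t(2) assms(4)] b unfolding live_def by blast
qed

text \<open>A visited vertex above \<open>z\<close> stays live, because some plausible hypothesis
  leads to \<open>z\<close>. Hence dead vertices lie in a branch off the path.\<close>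

lemma dead_excess:
  assumes "a < t" "t \<le> e"
  shows "dead t \<subseteq> excess"
proof
  fix w assume w: "w \<in> dead t"
  have t: "a \<le> t" "t \<le> Suc e" using assms by auto
  have wS: "w \<in> S t" using dead_S[OF assms w] .
  have wx: "anc w (x t)" using w unfolding dead_def by blast
  have nz: "\<not> anc w z"
  proof
    assume wz: "anc w z"
    obtain b where b: "b \<in> plausible \<beta> (S t)" "anc b z" using target_anc[OF t(1) assms(2)] by blast
    then have "b \<notin> S t" unfolding plausible_def boundary_def by blast
    then have "anc w b" using in_anc_bd(1)[OF S_closed[OF t] c_in[OF t] wS _ wz b(2)] by blast
    then show False using dead_not_live[OF assms w] b unfolding live_def by blast
  qed
  then have o: "off t" unfolding off_def using anc_trans[OF wx] by blast
  have "\<not> dep w \<le> dep (fork t)"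
    using anc_chain[OF wx fork(1)[OF assms o]] anc_trans[of w "fork t" z] fork(2)[OF assms o] nz by blast
  then have "anc (branch t) w"
    using anc_chain[OF branch(3)[OF assms o] wx] branch(2)[OF assms o] by simp
  moreover have "branch t \<in> branches" unfolding branches_def using assms o by blast
  moreover have "w \<in> S e" using wS S_mono[of t e] t assms by auto
  ultimately show "w \<in> excess" unfolding excess_def by blast
qed

lemma dead_sum: "(\<Sum>t\<in>{a<..e}. card (dead t)) \<le> card excess"
proof -
  have "(\<Sum>t\<in>{a<..e}. card (dead t)) = card (\<Union>t\<in>{a<..e}. dead t)"
  proof (rule card_UN_disjoint[symmetric])
    show "\<forall>t\<in>{a<..e}. \<forall>s\<in>{a<..e}. t \<noteq> s \<longrightarrow> dead t \<inter> dead s = {}"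
    proof (intro ballI impI)
      fix t s assume "t \<in> {a<..e}" "s \<in> {a<..e}" "t \<noteq> s"
      then show "dead t \<inter> dead s = {}"
        using dead_disjoint[of t s] dead_disjoint[of s t] by (cases "t < s") auto
    qed
  qed (simp_all add: dead_fin)
  also have "\<dots> \<le> card excess"
    by (intro card_mono[OF excess_fin] UN_least dead_excess) simp_all
  finally show ?thesis .
qed

text \<open>A lost family lies below \<open>turn t\<close>, since elsewhere \<open>x t\<close> and
  the rival look alike. Being right for \<open>x t\<close> it names \<open>w\<close>, whose child
  towards \<open>x t\<close> is dead. If it were right for \<open>z\<close>, then a rival leading to
  \<open>z\<close> would share this verdict, and otherwise \<open>z\<close> would lie below
  \<open>w\<close>, hence below \<open>turn t\<close>.\<close>

lemma lostD:
  assumes t: "a < t" "t \<le> e" and u: "u \<in> lost t"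
  defines "w \<equiv> meet u (x t)"
  shows "u \<in> V" "anc (turn t) u" "anc w u" "f u + 2 * int (dep w) = D + int (dep u)"
    "{w, toward w (x t)} \<in> E" "toward w (x t) \<in> dead t" "u \<in> F"
proof -
  have s: "a \<le> t - 1" "t - 1 \<le> Suc e" "t - 1 < t" "t - 1 \<le> e" "t \<le> Suc e" "a \<le> t" using t by auto
  have uS: "u \<in> S (t - 1)" and r: "right u (x t)" and nr: "\<not> right u (rival t)"
    using u unfolding lost_def by blast+
  show uV: "u \<in> V" using uS S_V[OF s(1,2)] by blast
  have xV: "x t \<in> V" using x_V s by blast
  show q: "anc (turn t) u" using right_outside[OF turn(1)[OF t] rival(2)[OF t] uV] r nr by blast
  show wu: "anc w u" unfolding w_def using meet(1)[OF uV xV] .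
  have wx: "anc w (x t)" unfolding w_def using meet(2)[OF uV xV] .
  show fw: "f u + 2 * int (dep w) = D + int (dep u)" unfolding w_def using right_self[OF uV xV r] .
  have "w \<noteq> x t"
    using anc_in[OF S_closed[OF s(1,2)] c_in[OF s(1,2)] uS wu] x_fresh[OF s(1,3,5)] by metis
  note k = toward[OF wx this]
  show "{w, toward w (x t)} \<in> E" by (rule k)
  have qw: "anc (turn t) w" unfolding w_def using meet_greatest[OF q turn(1)[OF t]] .
  then show "toward w (x t) \<in> dead t" unfolding dead_def using anc_dep[OF qw] k by simp
  have uSe: "u \<in> S e" using uS S_mono[OF s(1,4)] by auto
  have "\<not> right u z"
  proof
    assume rz: "right u z"
    show False
    proof (cases "anc (turn t) z")
      case True
      note y = rival[OF t]
      have "rival t \<notin> S t" using y(1) unfolding plausible_def boundary_def by blast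
      moreover have "u \<in> S t" using uS S_mono[OF s(1) less_imp_le[OF s(3)] s(5)] by blast
      ultimately have "right u (rival t) \<longleftrightarrow> right u z"
        using right_bd[OF S_closed[OF s(6,5)] c_in[OF s(6,5)]] y(3)[OF True] by blast
      then show False using nr rz by blast
    next
      case False
      have "dep (meet u z) = dep w" using right_self[OF uV z_V rz] fw by linarith
      then have "meet u z = w" using anc_unique[OF meet(1)[OF uV z_V] wu] by blast
      then have "anc w z" using meet(2)[OF uV z_V] by simp
      then show False using False anc_trans[OF qw] by blast
    qed
  qed
  then show "u \<in> F" unfolding F_def using uSe by blast
qed

text \<open>The prediction of \<open>u\<close> names one fixed \<open>w\<close>. Each time
  \<open>u\<close> is lost a child of \<open>w\<close> is dead, and no vertex is dead at two times;
  so these children are distinct neighbours of \<open>w\<close>.\<close>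

lemma lost_sum: "(\<Sum>t\<in>{a<..e}. card (lost t)) \<le> \<Delta> * card F"
proof (rule double_count[OF _ F_fin])
  show "lost t \<subseteq> F" if "t \<in> {a<..e}" for t using lostD(7)[of t] that by auto
  fix u assume "u \<in> F"
  show "card {t \<in> {a<..e}. u \<in> lost t} \<le> \<Delta>"
  proof (cases "{t \<in> {a<..e}. u \<in> lost t} = {}")
    case False
    then obtain t0 where t0: "a < t0" "t0 \<le> e" "u \<in> lost t0" by auto
    define w where "w = meet u (x t0)"
    have same: "meet u (x t) = w" if "a < t" "t \<le> e" "u \<in> lost t" for t
      using anc_unique[OF lostD(3)[OF that] lostD(3)[OF t0]] lostD(4)[OF that] lostD(4)[OF t0]
      unfolding w_def by linarith
    have "inj_on (\<lambda>t. toward w (x t)) {t \<in> {a<..e}. u \<in> lost t}"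
    proof (rule inj_onI)
      fix t s assume t: "t \<in> {t \<in> {a<..e}. u \<in> lost t}" and s: "s \<in> {t \<in> {a<..e}. u \<in> lost t}"
        and eq: "toward w (x t) = toward w (x s)"
      have "toward w (x t) \<in> dead t" "toward w (x s) \<in> dead s"
        using lostD(6)[of t u] lostD(6)[of s u] same t s by auto
      then show "t = s" using dead_disjoint[of t s] dead_disjoint[of s t] eq t s
        by (cases t s rule: linorder_cases) auto
    qed
    moreover have "(\<lambda>t. toward w (x t)) ` {t \<in> {a<..e}. u \<in> lost t} \<subseteq> {v. {w, v} \<in> E}"
      using lostD(5) same by fastforce
    ultimately have "card {t \<in> {a<..e}. u \<in> lost t} \<le> card {v. {w, v} \<in> E}"
      using neighbours_fin card_inj_on_le by blast
    also have "\<dots> \<le> \<Delta>" using degree anc_V[OF lostD(3)[OF t0]] unfolding w_def by blast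
    finally show ?thesis .
  next
    case True
    then show ?thesis by (simp only: card.empty)
  qed
qed simp

text \<open>Accounts for the family of the newly visited \<open>x t\<close>, which may be a new
  mistake of the rival.\<close>

definition charged :: "nat \<Rightarrow> nat" where
  "charged t = (if off t \<or> x t \<in> F then 1 else 0)"

lemma charged_sum: "(\<Sum>t\<in>{a<..e}. charged t) \<le> card excess + card F"
proof -
  have "(\<Sum>t\<in>{a<..e}. charged t) = card {t \<in> {a<..e}. off t \<or> x t \<in> F}"
    unfolding charged_def by (simp add: sum.If_cases Int_def)
  also have "\<dots> \<le> card (excess \<union> F)"
  proof (rule card_inj_on_le)
    show "inj_on x {t \<in> {a<..e}. off t \<or> x t \<in> F}"
    proof (rule inj_onI)
      fix t s assume "t \<in> {t \<in> {a<..e}. off t \<or> x t \<in> F}" "s \<in> {t \<in> {a<..e}. off t \<or> x t \<in> F}" "x t = x s"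
      then show "t = s" using x_inj[of t s] x_inj[of s t] by (cases t s rule: linorder_cases) auto
    qed
    show "x ` {t \<in> {a<..e}. off t \<or> x t \<in> F} \<subseteq> excess \<union> F" using off_excess by auto
  qed (use excess_fin F_fin in simp)
  also have "\<dots> \<le> card excess + card F" by (rule card_Un_le)
  finally show ?thesis .
qed

lemma err_step:
  assumes "a < t" "t \<le> e"
  shows "err (S t) (rival t) \<le> err (S (t - 1)) (x t) + charged t + card (lost t)"
proof -
  have s: "a \<le> t - 1" "t - 1 \<le> e" "t - 1 \<le> Suc e" "Suc (t - 1) = t" "t \<le> Suc e" "a \<le> t" using assms by auto
  have St: "S t = insert (x t) (S (t - 1))" using S_Suc[OF s(1,2)] s(4) by simp
  define N where "N = {u \<in> {x t}. \<not> right u (rival t)}"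
  have "{u \<in> S t. \<not> right u (rival t)} \<subseteq> {u \<in> S (t - 1). \<not> right u (x t)} \<union> N \<union> lost t"
    unfolding St lost_def N_def by blast
  moreover have "finite ({u \<in> S (t - 1). \<not> right u (x t)} \<union> N \<union> lost t)"
    unfolding N_def lost_def using S_fin[OF s(1,3)] by simp
  ultimately have "err (S t) (rival t) \<le> card ({u \<in> S (t - 1). \<not> right u (x t)} \<union> N \<union> lost t)"
    unfolding err_def by (rule card_mono[rotated])
  also have "\<dots> \<le> err (S (t - 1)) (x t) + card N + card (lost t)"
    unfolding err_def by (meson add_le_mono1 card_Un_le le_trans)
  also have "card N \<le> charged t"
  proof (cases "\<not> off t \<and> \<not> right (x t) (rival t)")
    case True
    \<comment> \<open>On the path to \<open>z\<close> the vertex \<open>x t\<close> is live, so the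
      turn is \<open>x t\<close> itself and the rival leads to \<open>z\<close>; thus a new mistake
      of the rival is also one of \<open>z\<close>.\<close>
    then have xz: "anc (x t) z" unfolding off_def by blast
    obtain b where b: "b \<in> plausible \<beta> (S t)" "anc b z" using target_anc[OF s(6) assms(2)] by blast
    then have "b \<notin> S t" unfolding plausible_def boundary_def by blast
    then have "anc (x t) b"
      using in_anc_bd(1)[OF S_closed[OF s(6,5)] c_in[OF s(6,5)] x_in[OF s(6,5)] _ xz b(2)] by blast
    then have "live t (x t)" unfolding live_def using b by blast
    then have "dep (x t) \<le> dep (turn t)" using turn(3)[OF assms] anc_refl x_V[OF s(6,5)] by blast
    then have "turn t = x t" using anc_eq[OF turn(1)[OF assms]] by blast
    then have "anc (rival t) z" using rival(3)[OF assms] xz by simp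
    moreover have "rival t \<notin> S t" using rival(1)[OF assms] unfolding plausible_def boundary_def by blast
    ultimately have "\<not> right (x t) z"
      using right_bd[OF S_closed[OF s(6,5)] c_in[OF s(6,5)] _ _ x_in[OF s(6,5)]] True by blast
    moreover have "x t \<in> S e" using x_in[OF s(6,5)] S_mono[of t e] assms by auto
    ultimately have "x t \<in> F" unfolding F_def by blast
    moreover have "card N \<le> card {x t}" unfolding N_def by (rule card_mono) auto
    ultimately show ?thesis unfolding charged_def by simp
  next
    case False
    then consider "off t" | "right (x t) (rival t)" by blast
    then show ?thesis
    proof cases
      case 1
      have "card N \<le> card {x t}" unfolding N_def by (rule card_mono) auto
      then show ?thesis using 1 unfolding charged_def by simp
    next
      case 2
      then have "N = {}" unfolding N_def by blast
      then show ?thesis by simp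
    qed
  qed
  finally show ?thesis by simp
qed

text \<open>Twice the number of levels climbed in the move.\<close>

definition up :: "nat \<Rightarrow> int" where
  "up t = int (d (x t) (x (Suc t))) + int (dep (x t)) - int (dep (x (Suc t)))"

text \<open>An amortization whose potential is four times the mistakes of the chosen hypothesis. The
  rule compares the choice with the rival, and the climb towards the rival covers at most the dead
  vertices.\<close>

lemma up_step:
  assumes "a < t" "t \<le> e"
  shows "up t \<le> 4 * int (err (S (t - 1)) (x t)) - 4 * int (err (S t) (x (Suc t)))
    + int (4 * charged t + 4 * card (lost t) + 2 * card (dead t))"
proof -
  have t: "a \<le> t" using assms by simp
  have "dep (x t) \<le> dep (turn t) + card (dead t)"
    by (rule dep_diff_le_card[OF turn(1)[OF assms] dead_fin]) (auto simp: dead_def)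
  then show ?thesis
    using x_least[OF t assms(2) rival(1)[OF assms]] err_step[OF assms]
      d_le_via[OF turn(1)[OF assms] rival(2)[OF assms]]
    unfolding up_def by linarith
qed

lemma telescope:
  assumes "a \<le> n" "n \<le> e"
  shows "(\<Sum>t\<in>{a<..n}. up t) \<le> 4 * int (err (S a) (x (Suc a))) - 4 * int (err (S n) (x (Suc n)))
    + (\<Sum>t\<in>{a<..n}. int (4 * charged t + 4 * card (lost t) + 2 * card (dead t)))"
  using assms
proof (induction n rule: dec_induct)
  case (step n)
  have "{a<..Suc n} = insert (Suc n) {a<..n}" using step by auto
  then show ?case using step up_step[of "Suc n"] by simp
qed simp

text \<open>The sum of \<open>up t\<close> is the cost minus the change of depth. The climb towards
  the initial hypothesis \<open>b\<close> remains as a separate term, since it depends on where the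
  run starts.\<close>

lemma run_cost:
  assumes b: "b \<in> plausible \<beta> (S a)" "anc b z"
  shows "(\<Sum>t = a..e. int (d (x t) (x (Suc t))))
    \<le> int (dep z) - int (dep (x a)) + (int (d (x a) b) + int (dep (x a)) - int (dep b))
      + 72 * int \<Delta> * int (card F)"
proof -
  define P where "P = \<Delta> * card F"
  define X where "X = (\<Sum>t\<in>{a<..e}. up t)"
  have bS: "b \<notin> S a" using b unfolding plausible_def boundary_def by blast
  have errb: "err (S a) b \<le> card F"
  proof -
    have "err (S a) b = err (S a) z" using err_anc[OF start(1,2) bS b(2)] .
    also have "\<dots> \<le> err (S e) z" using err_mono[OF S_mono[of a e] S_V[of e]] ae by simp
    finally show ?thesis unfolding err_def F_def .
  qed
  have first: "up a + 4 * int (err (S a) (x (Suc a)))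
    \<le> 4 * int (card F) + (int (d (x a) b) + int (dep (x a)) - int (dep b))"
    using x_least[OF order_refl ae b(1)] errb unfolding up_def by linarith
  have "(\<Sum>t\<in>{a<..e}. int (4 * charged t + 4 * card (lost t) + 2 * card (dead t)))
    = int (4 * (\<Sum>t\<in>{a<..e}. charged t) + 4 * (\<Sum>t\<in>{a<..e}. card (lost t)) + 2 * (\<Sum>t\<in>{a<..e}. card (dead t)))"
    by (simp add: sum.distrib sum_distrib_left)
  also have "\<dots> \<le> int (4 * (card excess + card F) + 4 * (\<Delta> * card F) + 2 * card excess)"
    unfolding of_nat_le_iff by (intro add_mono mult_le_mono2 charged_sum lost_sum dead_sum)
  also have "\<dots> = 6 * int (card excess) + 4 * int (card F) + 4 * int P"
    unfolding P_def by simp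
  finally have "X \<le> 4 * int (err (S a) (x (Suc a)))
      + (6 * int (card excess) + 4 * int (card F) + 4 * int P)"
    using telescope[OF ae order_refl] unfolding X_def by linarith
  moreover have "int (card F) \<le> int P" using \<Delta> unfolding P_def of_nat_le_iff by simp
  moreover have "int (card excess) \<le> 10 * int P" using excess_card unfolding P_def by (simp flip: of_nat_mult)
  \<comment> \<open>\<open>72 = 6 * 10 + 4 + 4 + 4\<close>: the excess, the charged families of
    \<open>F\<close>, the lost families, and the initial mistakes.\<close>
  ultimately have "up a + X \<le> (int (d (x a) b) + int (dep (x a)) - int (dep b)) + 72 * int P"
    using first by linarith
  moreover have "{a..e} = insert a {a<..e}" using ae by auto
  then have "(\<Sum>t = a..e. up t) = up a + X" unfolding X_def by simp
  moreover have "(\<Sum>t = a..e. up t)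
    = (\<Sum>t = a..e. int (d (x t) (x (Suc t)))) - (\<Sum>t = a..e. int (dep (x (Suc t))) - int (dep (x t)))"
    unfolding up_def sum_subtractf[symmetric] by (rule sum.cong) simp_all
  moreover have "(\<Sum>t = a..e. int (dep (x (Suc t))) - int (dep (x t))) = int (dep z) - int (dep (x a))"
    using sum_Suc_diff[of a e "\<lambda>t. int (dep (x t))"] ae unfolding z_def by simp
  ultimately show ?thesis unfolding P_def by simp
qed

end

section \<open>The algorithm\<close>

text \<open>Phase \<open>i\<close> is meant for at most \<open>2 ^ i - 1\<close> erroneous vertices. It is abandoned only when every
  hypothesis makes more than \<open>tolerance i = sample_size (Suc i)\<close> mistakes, so the sample of the next
  phase has been visited by then.\<close>

definition sample_size :: "nat \<Rightarrow> nat" where "sample_size i = 4 * (2 ^ i - 1)"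

definition tolerance :: "nat \<Rightarrow> nat" where "tolerance i = 8 * 2 ^ i - 4"

definition sample :: "nat \<Rightarrow> 'v list \<Rightarrow> 'v set" where
  "sample i vs = set (take (Suc (sample_size i)) vs)"

definition median :: "('v \<Rightarrow> 'v \<Rightarrow> nat) \<Rightarrow> 'v set \<Rightarrow> 'v" where
  "median dst R = arg_min (\<lambda>c. \<Sum>v\<in>R. dst c v) (\<lambda>c. c \<in> R)"

text \<open>At least half of the sample reaches the goal through its median \<open>c\<close>, and \<open>h v - dst v c\<close> is the
  distance from \<open>c\<close> to the goal for each correct such vertex \<open>v\<close>. Including \<open>h c\<close> keeps the set nonempty.\<close>

definition guesses :: "('v \<Rightarrow> 'v \<Rightarrow> nat) \<Rightarrow> ('v \<Rightarrow> int) \<Rightarrow> nat \<Rightarrow> 'v set \<Rightarrow> 'v \<Rightarrow> int set" where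
  "guesses dst h i R c = {D. D = h c \<or> 2 ^ i \<le> card {v \<in> R. h v - int (dst v c) = D}}"

definition mistakes ::
  "('v \<Rightarrow> 'v \<Rightarrow> nat) \<Rightarrow> 'v set set \<Rightarrow> ('v \<Rightarrow> int) \<Rightarrow> 'v \<Rightarrow> int \<Rightarrow> 'v set \<Rightarrow> 'v \<Rightarrow> nat" where
  "mistakes dst E h c D S b = card {u \<in> S. \<not> (\<forall>v\<in>{v. v = u \<or> {u, v} \<in> E \<and> dst c v = Suc (dst c u)}.
     h v = int (dst v b) + D - int (dst c b))}"

definition obs_dist :: "'v observation \<Rightarrow> 'v \<Rightarrow> 'v \<Rightarrow> nat" where
  "obs_dist ob = graph_dist (set (obs_visited ob) \<union> obs_boundary ob) (obs_edges ob)"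

definition obs_value :: "'v observation \<Rightarrow> 'v \<Rightarrow> int" where
  "obs_value ob v = the (obs_pred ob v)"

definition obs_centre :: "'v observation \<Rightarrow> nat \<Rightarrow> 'v" where
  "obs_centre ob i = median (obs_dist ob) (sample i (obs_visited ob))"

definition obs_guesses :: "'v observation \<Rightarrow> nat \<Rightarrow> int set" where
  "obs_guesses ob i =
    guesses (obs_dist ob) (obs_value ob) i (sample i (obs_visited ob)) (obs_centre ob i)"

definition obs_mistakes :: "'v observation \<Rightarrow> nat \<Rightarrow> int \<Rightarrow> 'v \<Rightarrow> nat" where
  "obs_mistakes ob i D =
    mistakes (obs_dist ob) (obs_edges ob) (obs_value ob) (obs_centre ob i) D (set (obs_visited ob))"

definition obs_plausible :: "'v observation \<Rightarrow> nat \<Rightarrow> int \<Rightarrow> 'v set" where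
  "obs_plausible ob i D = {b \<in> obs_boundary ob. obs_mistakes ob i D b \<le> tolerance i}"

definition obs_alive :: "'v observation \<Rightarrow> nat \<Rightarrow> int set" where
  "obs_alive ob i = {D \<in> obs_guesses ob i. obs_plausible ob i D \<noteq> {}}"

definition obs_phase :: "'v observation \<Rightarrow> nat" where
  "obs_phase ob = (LEAST i. obs_alive ob i \<noteq> {})"

text \<open>The score is four times the number of mistakes plus twice the length of the upward part of the
  move, where \<open>c\<close> is the root. By the triangle inequality the subtraction does not truncate.\<close>

definition obs_choice :: "'v observation \<Rightarrow> 'v" where
  "obs_choice ob = (let i = obs_phase ob; D = Min (obs_alive ob i); c = obs_centre ob i;
      p = last (obs_visited ob) in
    arg_min (\<lambda>b. 4 * obs_mistakes ob i D b + obs_dist ob p b + obs_dist ob c p - obs_dist ob c b)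
      (\<lambda>b. b \<in> obs_plausible ob i D))"

text \<open>The fallback keeps the move legal for every observation with a nonempty boundary,
  including those that no search produces, as \<open>exploration_algorithm\<close> demands.\<close>

definition explorer :: "'v observation \<Rightarrow> 'v" where
  "explorer ob = (if obs_choice ob \<in> obs_boundary ob then obs_choice ob
    else SOME b. b \<in> obs_boundary ob)"

lemma explorer_algorithm: "exploration_algorithm explorer"
  unfolding exploration_algorithm_def explorer_def by (auto intro: someI_ex)

lemma arg_min_cong: "(\<And>y. P y \<Longrightarrow> h y = h' y) \<Longrightarrow> arg_min h P = arg_min h' P"
  unfolding arg_min_def is_arg_min_def by (rule arg_cong[where f = Eps]) auto

lemma guesses_finite: "finite R \<Longrightarrow> finite (guesses dst h i R c)"
proof -
  assume "finite R"
  moreover have "guesses dst h i R c \<subseteq> insert (h c) ((\<lambda>v. h v - int (dst v c)) ` R)"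
  proof
    fix D assume D: "D \<in> guesses dst h i R c"
    show "D \<in> insert (h c) ((\<lambda>v. h v - int (dst v c)) ` R)"
    proof (cases "D = h c")
      case False
      then have "2 ^ i \<le> card {v \<in> R. h v - int (dst v c) = D}" using D unfolding guesses_def by blast
      then have "card {v \<in> R. h v - int (dst v c) = D} \<noteq> 0" by (metis not_le zero_less_numeral zero_less_power)
      then have "{v \<in> R. h v - int (dst v c) = D} \<noteq> {}" by (metis card.empty)
      then show ?thesis by blast
    qed simp
  qed
  ultimately show ?thesis by (meson finite_imageI finite_insert finite_subset)
qed

text \<open>Each guess other than \<open>h c\<close> claims \<open>2 ^ i\<close> sample vertices of
  its own, and the sample has fewer than \<open>4 * 2 ^ i\<close>; so there are at most three such
  guesses.\<close>

lemma guesses_card: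
  assumes "finite R" "card R \<le> Suc (sample_size i)"
  shows "card (guesses dst h i R c) \<le> 4"
proof -
  define X where "X = guesses dst h i R c - {h c}"
  have fin: "finite X" unfolding X_def using guesses_finite[OF assms(1)] by simp
  have "card X * 2 ^ i = (\<Sum>D\<in>X. 2 ^ i)" by simp
  also have "\<dots> \<le> (\<Sum>D\<in>X. card {v \<in> R. h v - int (dst v c) = D})"
    by (rule sum_mono) (auto simp: X_def guesses_def)
  also have "\<dots> = card (\<Union>D\<in>X. {v \<in> R. h v - int (dst v c) = D})"
    using assms(1) fin by (intro card_UN_disjoint[symmetric]) auto
  also have "\<dots> \<le> card R" using assms(1) by (intro card_mono) auto
  also have "\<dots> < 4 * 2 ^ i"
  proof -
    have "(1::nat) \<le> 2 ^ i" by simp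
    then show ?thesis using assms(2) unfolding sample_size_def by linarith
  qed
  finally have "card X < 4" by simp
  moreover have "guesses dst h i R c \<subseteq> insert (h c) X" unfolding X_def by blast
  then have "card (guesses dst h i R c) \<le> card (insert (h c) X)" using fin by (intro card_mono) auto
  ultimately show ?thesis using card_insert_if[OF fin, of "h c"] by (auto split: if_splits)
qed

section \<open>The known subtree, medians and the true hypothesis\<close>

context tree
begin

lemma geod_closed_boundary:
  assumes "geod_closed S" "B \<subseteq> boundary V E S"
  shows "geod_closed (S \<union> B)"
proof -
  have "finite B" using finite_subset[OF _ finite_V] assms(2) unfolding boundary_def by blast
  then show ?thesis using assms(2)
  proof (induction B rule: finite_induct)
    case (insert b B)
    then have "geod_closed (S \<union> B)" by simp
    moreover have "b \<in> boundary V E (S \<union> B)" using insert unfolding boundary_def by blast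
    ultimately show ?case using geod_closed_insert by fastforce
  qed (use assms in simp)
qed

text \<open>Shortest paths between vertices of a convex \<open>K\<close> run inside
  \<open>K\<close>, so the agent measures true distances.\<close>

lemma graph_dist_closed:
  assumes K: "geod_closed K" and uv: "u \<in> K" "v \<in> K"
  shows "graph_dist K {e \<in> E. e \<subseteq> K} u v = d u v"
proof -
  let ?E = "{e \<in> E. e \<subseteq> K}"
  have KV: "K \<subseteq> V" using K unfolding geod_closed_def by blast
  have "\<exists>p. walk_betw K ?E u p v \<and> length p = Suc (d u v)" using uv(2)
  proof (induction "d u v" arbitrary: v)
    case 0
    then have "u = v" using d_0[of u v] uv KV by auto
    then show ?case using 0 uv by (intro exI[of _ "[u]"]) (auto simp: walk_betw_def walk_def)
  next
    case (Suc k)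
    have V: "u \<in> V" "v \<in> V" using uv(1) Suc(3) KV by auto
    obtain w where w: "{w, v} \<in> E" "d u w = k" "w \<in> V" using d_step[OF V Suc(2)[symmetric]] .
    then have "d u v = d u w + d w v" using d_adj Suc(2) by simp
    then have wK: "w \<in> K" using K uv(1) Suc(3) w(3) unfolding geod_closed_def by blast
    then obtain p where p: "walk_betw K ?E u p w" "length p = Suc k" using Suc(1)[of w] w by auto
    have "walk_betw K ?E u (p @ [v]) v"
      using p wK w Suc(3) unfolding walk_betw_def walk_def by (auto simp: successively_append_iff)
    then show ?case using p Suc(2) by (intro exI[of _ "p @ [v]"]) auto
  qed
  then obtain p where p: "walk_betw K ?E u p v" "length p = Suc (d u v)" by blast
  then have "graph_dist K ?E u v \<le> d u v" unfolding graph_dist_def by (intro Least_le) blast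
  moreover have "d u v \<le> graph_dist K ?E u v"
  proof -
    have "\<exists>n p. walk_betw K ?E u p v \<and> length p = Suc n" using p by blast
    from LeastI_ex[OF this, folded graph_dist_def]
    obtain q where q: "walk_betw K ?E u q v" "length q = Suc (graph_dist K ?E u v)" by blast
    have "walk_betw V E u q v"
      using q(1) KV unfolding walk_betw_def walk_def by (auto elim: successively_mono)
    then show ?thesis using d_le q(2) by blast
  qed
  ultimately show ?thesis by simp
qed

text \<open>Let \<open>c'\<close> be the neighbour of the median \<open>c\<close> towards
  \<open>g\<close>. The vertices nearer to \<open>c\<close> reach \<open>g\<close> through
  \<open>c\<close>. If those nearer to \<open>c'\<close> were more numerous, \<open>c'\<close> would
  lie in \<open>R\<close> and have a smaller sum of distances.\<close>

lemma median_majority: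
  assumes R: "geod_closed R" "finite R" "R \<noteq> {}" and g: "g \<in> V" "g \<notin> R"
  shows "card R \<le> 2 * card {v \<in> R. d v g = d v (median d R) + d (median d R) g}"
    "median d R \<in> R"
proof -
  define c where "c = median d R"
  have cR: "c \<in> R" unfolding c_def median_def using R(3) arg_min_natI[of "\<lambda>c. c \<in> R"] by blast
  then show "median d R \<in> R" unfolding c_def .
  have min: "(\<Sum>v\<in>R. d c v) \<le> (\<Sum>v\<in>R. d y v)" if "y \<in> R" for y
    unfolding c_def median_def
    using arg_min_nat_le[of "\<lambda>c. c \<in> R" y "\<lambda>c. \<Sum>v\<in>R. d c v"] that by blast
  have RV: "R \<subseteq> V" using R(1) unfolding geod_closed_def by blast
  then have cV: "c \<in> V" using cR by blast
  have "d g c \<noteq> 0" using d_0[OF g(1) cV] cR g by auto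
  then obtain k where "d g c = Suc k" by (cases "d g c") auto
  then obtain c' where c': "{c', c} \<in> E" "d g c = Suc (d g c')" "c' \<in> V"
    using d_step[OF g(1) cV] by metis
  then have ce: "{c, c'} \<in> E" by (simp add: insert_commute)
  define X where "X = {v \<in> R. d v c' = Suc (d v c)}"
  define Y where "Y = {v \<in> R. d v c = Suc (d v c')}"
  have XY: "R = X \<union> Y" "X \<inter> Y = {}"
    using adj_d_cases[OF _ ce] RV unfolding X_def Y_def by auto
  have fin: "finite X" "finite Y" using R(2) unfolding X_def Y_def by simp_all
  have "card Y \<le> card X"
  proof (cases "Y = {}")
    case False
    then obtain v where v: "v \<in> R" "d v c = Suc (d v c')" unfolding Y_def by blast
    have "d v c = d v c' + d c' c" using v(2) d_adj[OF c'(1)] by simp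
    then have "c' \<in> R" using R(1) v(1) cR c'(3) unfolding geod_closed_def by blast
    then have "(\<Sum>v\<in>R. d c v) \<le> (\<Sum>v\<in>R. d c' v)" by (rule min)
    moreover have "(\<Sum>v\<in>R. d y v) = (\<Sum>v\<in>X. d v y) + (\<Sum>v\<in>Y. d v y)" if "y \<in> V" for y
    proof -
      have "(\<Sum>v\<in>R. d y v) = (\<Sum>v\<in>R. d v y)" using d_sym[OF that] RV by (intro sum.cong) auto
      also have "\<dots> = (\<Sum>v\<in>X. d v y) + (\<Sum>v\<in>Y. d v y)"
        unfolding XY(1) using fin XY(2) by (rule sum.union_disjoint)
      finally show ?thesis .
    qed
    moreover have "(\<Sum>v\<in>X. d v c') = (\<Sum>v\<in>X. d v c) + card X"
      unfolding X_def by (simp add: sum.distrib flip: sum_Suc)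
    moreover have "(\<Sum>v\<in>Y. d v c) = (\<Sum>v\<in>Y. d v c') + card Y"
      unfolding Y_def by (simp add: sum.distrib flip: sum_Suc)
    ultimately show ?thesis using cV c'(3) by simp
  qed simp
  moreover have "card R = card X + card Y" unfolding XY(1) using fin XY(2) by (rule card_Un_disjoint)
  moreover have "X \<subseteq> {v \<in> R. d v g = d v c + d c g}"
  proof
    fix v assume v: "v \<in> X"
    then have "v \<in> V" "d v c' = Suc (d v c)" using RV unfolding X_def by auto
    then have "d v g = d v c + 1 + d c' g" using edge_separates[OF _ g(1) ce] c'(2) by blast
    moreover have "d c g = Suc (d c' g)" using c'(2) d_sym[OF g(1) cV] d_sym[OF g(1) c'(3)] by simp
    ultimately show "v \<in> {v \<in> R. d v g = d v c + d c g}" using v unfolding X_def by simp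
  qed
  then have "card X \<le> card {v \<in> R. d v g = d v c + d c g}" using R(2) by (intro card_mono) auto
  ultimately show "card R \<le> 2 * card {v \<in> R. d v g = d v (median d R) + d (median d R) g}"
    unfolding c_def by simp
qed

text \<open>An erroneous vertex spoils only its own family and that of its parent.\<close>

lemma mistakes_goal:
  assumes c: "c \<in> V" and S: "S \<subseteq> V" and g: "g \<in> V"
  shows "mistakes d E f c (int (d c g)) S g \<le> 2 * card (erroneous V E f g)"
proof -
  define G where "G v = {u. v = u \<or> ({u, v} \<in> E \<and> d c v = Suc (d c u))}" for v
  have finG: "finite (G v)" and cardG: "card (G v) \<le> 2" for v
  proof -
    have "\<exists>w. G v \<subseteq> {v, w}"
    proof (cases "\<exists>w. {w, v} \<in> E \<and> d c v = Suc (d c w)")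
      case True
      then obtain w where w: "{w, v} \<in> E" "d c v = Suc (d c w)" by blast
      have "G v \<subseteq> {v, w}"
        unfolding G_def using parent_unique[OF c _ w(1) _ w(2)] by blast
      then show ?thesis by blast
    next
      case False
      then have "G v \<subseteq> {v, v}" unfolding G_def by blast
      then show ?thesis by blast
    qed
    then obtain w where w: "G v \<subseteq> {v, w}" by blast
    then show "finite (G v)" by (rule finite_subset) simp
    have "card (G v) \<le> card {v, w}" using w by (rule card_mono[rotated]) simp
    also have "\<dots> \<le> 2" by (simp add: card_insert_if)
    finally show "card (G v) \<le> 2" .
  qed
  have fin: "finite (erroneous V E f g)" unfolding erroneous_def using finite_V by simp
  have "mistakes d E f c (int (d c g)) S g \<le> card (\<Union>v\<in>erroneous V E f g. G v)"
    unfolding mistakes_def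
  proof (rule card_mono)
    show "finite (\<Union>v\<in>erroneous V E f g. G v)" using fin finG by simp
    show "{u \<in> S. \<not> (\<forall>v\<in>{v. v = u \<or> {u, v} \<in> E \<and> d c v = Suc (d c u)}.
        f v = int (d v g) + int (d c g) - int (d c g))} \<subseteq> (\<Union>v\<in>erroneous V E f g. G v)"
      using S adj_V unfolding erroneous_def G_def by auto
  qed
  also have "\<dots> \<le> (\<Sum>v\<in>erroneous V E f g. card (G v))" by (rule card_UN_le[OF fin])
  also have "\<dots> \<le> (\<Sum>v\<in>erroneous V E f g. 2)" by (rule sum_mono) (rule cardG)
  finally show ?thesis by simp
qed

text \<open>On the path between two plausible vertices every interior vertex but one is mispredicted by
  one of the two hypotheses.\<close>

lemma plausible_close:
  assumes S: "geod_closed S" and p: "p \<in> boundary V E S" and b: "b \<in> boundary V E (insert p S)"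
  shows "d p b \<le> mistakes d E f c' D' S p + mistakes d E f c D (insert p S) b + 2"
proof -
  have S': "geod_closed (insert p S)" using geod_closed_insert[OF S p] .
  have V: "p \<in> V" "b \<in> V" "S \<subseteq> V" using p b S unfolding boundary_def geod_closed_def by blast+
  interpret P: rooted_tree V E p by (rule rooted_treeI[OF V(1)])
  define W' where "W' = {u \<in> S. \<not> (\<forall>v\<in>{v. v = u \<or> {u, v} \<in> E \<and> d c' v = Suc (d c' u)}.
     f v = int (d v p) + D' - int (d c' p))}"
  define W where "W = {u \<in> insert p S. \<not> (\<forall>v\<in>{v. v = u \<or> {u, v} \<in> E \<and> d c v = Suc (d c u)}.
     f v = int (d v b) + D - int (d c b))}"
  define K where "K = {k::nat. 2 * int k = int (d p b) + D - int (d c b) - D' + int (d c' p)}"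
  have "finite S" using V(3) finite_V finite_subset by blast
  then have fin: "finite W" "finite W'" unfolding W_def W'_def by simp_all
  have K: "finite K" "card K \<le> 1"
  proof -
    have sub: "K \<subseteq> {k}" if "k \<in> K" for k using that unfolding K_def by auto
    have *: "K = {} \<or> (\<exists>k. K = {k})"
    proof (cases "K = {}")
      case False
      then obtain k where "k \<in> K" by blast
      then show ?thesis using sub by blast
    qed simp
    show "finite K" "card K \<le> 1" using * by auto
  qed
  have "{1..<d p b} \<subseteq> d p ` (W' \<union> W) \<union> K"
  proof
    fix k assume k: "k \<in> {1..<d p b}"
    then obtain w where w: "P.anc w b" "d p w = k" using P.anc_at[OF V(2), of k] by auto
    have wb: "w \<noteq> b" "w \<noteq> p" using w k V by auto
    have "w \<in> insert p S" using P.bd_proper[OF S' _ b w(1) wb(1)] by blast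
    then have wS: "w \<in> S" "w \<in> V" using wb V(3) by auto
    have sum: "d p b = k + d w b" using w unfolding P.anc_def by simp
    have sym: "d w p = k" using d_sym[OF V(1) wS(2)] w by simp
    show "k \<in> d p ` (W' \<union> W) \<union> K"
    proof (cases "w \<in> W' \<union> W")
      case False
      then have "f w = int (d w p) + D' - int (d c' p)" "f w = int (d w b) + D - int (d c b)"
        using wS unfolding W'_def W_def by auto
      then have "2 * int k = int (d p b) + D - int (d c b) - D' + int (d c' p)"
        using sum sym by linarith
      then show ?thesis unfolding K_def by blast
    qed (use w in blast)
  qed
  then have "card {1..<d p b} \<le> card (d p ` (W' \<union> W) \<union> K)"
    using fin K by (intro card_mono) auto
  also have "\<dots> \<le> card (d p ` (W' \<union> W)) + card K" by (rule card_Un_le)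
  also have "card (d p ` (W' \<union> W)) \<le> card (W' \<union> W)" using fin by (intro card_image_le) simp
  also have "card (W' \<union> W) \<le> card W' + card W" by (rule card_Un_le)
  finally have "d p b - 1 \<le> card W' + card W + 1" using K by simp
  then show ?thesis unfolding mistakes_def W'_def W_def by linarith
qed

lemma degree_le: 
  assumes "w \<in> V"
  shows "card {v. {w, v} \<in> E} \<le> max_degree V E"
proof -
  have "card {v. {w, v} \<in> E} \<le> card {e \<in> E. w \<in> e}"
  proof (rule card_inj_on_le)
    show "inj_on (\<lambda>v. {w, v}) {v. {w, v} \<in> E}" by (rule inj_onI) (auto simp: doubleton_eq_iff)
    show "finite {e \<in> E. w \<in> e}" using finite_E by simp
  qed auto
  also have "\<dots> \<le> max_degree V E"
    unfolding max_degree_def vertex_degree_def using assms finite_V by (intro Max_ge) auto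
  finally show ?thesis .
qed

end

section \<open>The search\<close>

locale search = tree V E for V :: "'v set" and E +
  fixes f :: "'v \<Rightarrow> int" and r g :: 'v
  assumes r: "r \<in> V" and g: "g \<in> V"
begin

abbreviation vs :: "nat \<Rightarrow> 'v list" where "vs \<equiv> visits explorer V E f r"
abbreviation x :: "nat \<Rightarrow> 'v" where "x \<equiv> position explorer V E f r"
abbreviation S :: "nat \<Rightarrow> 'v set" where "S t \<equiv> set (vs t)"
abbreviation ob :: "nat \<Rightarrow> 'v observation" where "ob t \<equiv> observe V E f (vs t)"

lemma vs_Suc: "vs (Suc t) = vs t @ [x (Suc t)]"
  unfolding position_def by simp

lemma x_Suc: "x (Suc t) = explorer (ob t)"
  unfolding position_def by simp

lemma x_0: "x 0 = r"
  unfolding position_def by simp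

lemma length_vs: "length (vs t) = Suc t"
  by (induction t) simp_all

lemma S_Suc: "S (Suc t) = insert (x (Suc t)) (S t)"
  unfolding vs_Suc by simp

lemma take_vs: "k \<le> t \<Longrightarrow> take (Suc k) (vs t) = vs k"
proof (induction t)
  case (Suc t)
  then show ?case using length_vs[of t] length_vs[of "Suc t"] by (cases "k = Suc t") (simp_all add: vs_Suc del: visits.simps)
qed simp

lemma S_mono: "s \<le> t \<Longrightarrow> S s \<subseteq> S t"
  by (induction t rule: dec_induct) (simp_all add: S_Suc subset_insertI2 del: visits.simps)

lemma x_in: "x t \<in> S t"
  unfolding position_def using length_vs[of t] by (metis last_in_set length_0_conv nat.distinct(1))

lemma S_elem: "v \<in> S t \<Longrightarrow> \<exists>j\<le>t. v = x j"
proof (induction t)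
  case 0
  then show ?case using x_0 by simp
next
  case (Suc t)
  then consider "v = x (Suc t)" | "v \<in> S t" unfolding S_Suc by blast
  then show ?case
  proof cases
    case 2
    then show ?thesis using Suc le_SucI by blast
  qed blast
qed

lemma explorer_boundary: "boundary V E (S t) \<noteq> {} \<Longrightarrow> x (Suc t) \<in> boundary V E (S t)"
proof -
  assume "boundary V E (S t) \<noteq> {}"
  moreover have "obs_boundary (ob t) = boundary V E (S t)" by (simp add: observe_def Let_def)
  ultimately show "x (Suc t) \<in> boundary V E (S t)"
    using explorer_algorithm unfolding exploration_algorithm_def x_Suc by metis
qed

lemma boundary_nonempty:
  assumes "geod_closed (S t)" "g \<notin> S t"
  shows "boundary V E (S t) \<noteq> {}"
proof -
  interpret R: rooted_tree V E r by (rule rooted_treeI[OF r])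
  have "r \<in> S t" using S_mono[of 0 t] by simp
  then show ?thesis using R.bd_anc_ex[OF assms(1) _ g assms(2)] by blast
qed

lemma S_closed: "g \<notin> S t \<Longrightarrow> geod_closed (S t)"
proof (induction t)
  case 0
  then show ?case using geod_closed_sing[OF r] by simp
next
  case (Suc t)
  then have "geod_closed (S t)" "g \<notin> S t" using S_mono[of t "Suc t"] by auto
  then show ?case
    using geod_closed_insert explorer_boundary boundary_nonempty unfolding S_Suc by blast
qed

lemma x_boundary: "g \<notin> S t \<Longrightarrow> x (Suc t) \<in> boundary V E (S t)"
  using explorer_boundary boundary_nonempty S_closed by blast

lemma card_S: "g \<notin> S t \<Longrightarrow> card (S t) = Suc t"
proof (induction t)
  case (Suc t)
  then have "g \<notin> S t" using S_mono[of t "Suc t"] by auto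
  then show ?case using Suc x_boundary[of t] unfolding S_Suc boundary_def by auto
qed simp

lemma S_V: "g \<notin> S t \<Longrightarrow> S t \<subseteq> V"
  using S_closed unfolding geod_closed_def by blast

lemma dist_x:
  assumes "g \<notin> S t" "j \<le> t"
  shows "d r (x j) \<le> j"
  using assms
proof (induction j rule: less_induct)
  case (less j)
  show ?case
  proof (cases j)
    case 0
    then show ?thesis using x_0 r by simp
  next
    case (Suc k)
    have "g \<notin> S k" using less.prems Suc S_mono[of k t] by auto
    then obtain y where y: "y \<in> S k" "{y, x (Suc k)} \<in> E"
      using x_boundary unfolding boundary_def by blast
    obtain i where i: "i \<le> k" "y = x i" using S_elem[OF y(1)] by blast
    have "d r (x i) \<le> i" using less i Suc by simp
    then show ?thesis using d_adj_le[OF r y(2)] i Suc by simp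
  qed
qed

section \<open>The agent's computations expressed in the true tree\<close>

definition sampled :: "nat \<Rightarrow> nat \<Rightarrow> 'v set" where "sampled t i = sample i (vs t)"
definition centre :: "nat \<Rightarrow> nat \<Rightarrow> 'v" where "centre t i = median d (sampled t i)"
definition guessed :: "nat \<Rightarrow> nat \<Rightarrow> int set" where "guessed t i = guesses d f i (sampled t i) (centre t i)"
definition misfit :: "nat \<Rightarrow> nat \<Rightarrow> int \<Rightarrow> 'v \<Rightarrow> nat" where
  "misfit t i D b = mistakes d E f (centre t i) D (S t) b"
definition candidates :: "nat \<Rightarrow> nat \<Rightarrow> int \<Rightarrow> 'v set" where
  "candidates t i D = {b \<in> boundary V E (S t). misfit t i D b \<le> tolerance i}"
definition alive :: "nat \<Rightarrow> nat \<Rightarrow> int set" where "alive t i = {D \<in> guessed t i. candidates t i D \<noteq> {}}"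
definition phase :: "nat \<Rightarrow> nat" where "phase t = (LEAST i. alive t i \<noteq> {})"
definition guess :: "nat \<Rightarrow> int" where "guess t = Min (alive t (phase t))"

lemma sampled_sub: "sampled t i \<subseteq> S t"
  unfolding sampled_def sample_def by (rule set_take_subset)

lemma sampled_finite: "finite (sampled t i)"
  using finite_subset[OF sampled_sub] by simp

lemma sampled_eq: "sample_size i \<le> t \<Longrightarrow> sampled t i = S (sample_size i)"
  unfolding sampled_def sample_def by (simp add: take_vs)

lemma sampled_nonempty: "sampled t i \<noteq> {}"
  unfolding sampled_def sample_def using length_vs[of t] by (metis list.size(3) nat.distinct(1) set_empty2 take_eq_Nil)

lemma centre_sampled: "centre t i \<in> sampled t i"
  unfolding centre_def median_def using sampled_nonempty arg_min_natI[of "\<lambda>c. c \<in> sampled t i"] by blast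

lemma centre_S: "centre t i \<in> S t"
  using centre_sampled sampled_sub by blast

lemma obs_simps: "obs_visited (ob t) = vs t" "obs_boundary (ob t) = boundary V E (S t)"
  "obs_edges (ob t) = {e \<in> E. e \<subseteq> S t \<union> boundary V E (S t)}"
  "v \<in> S t \<union> boundary V E (S t) \<Longrightarrow> obs_value (ob t) v = f v"
  unfolding obs_value_def observe_def Let_def by simp_all

lemma obs_dist_eq:
  assumes "g \<notin> S t" "u \<in> S t \<union> boundary V E (S t)" "v \<in> S t \<union> boundary V E (S t)"
  shows "obs_dist (ob t) u v = d u v"
  unfolding obs_dist_def obs_simps
  using graph_dist_closed[OF geod_closed_boundary[OF S_closed[OF assms(1)] order_refl]] assms by blast

lemma obs_centre_eq:
  assumes "g \<notin> S t"
  shows "obs_centre (ob t) i = centre t i"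
  unfolding obs_centre_def centre_def median_def obs_simps sampled_def[symmetric]
proof (rule arg_min_cong)
  fix y assume "y \<in> sampled t i"
  then show "(\<Sum>v\<in>sampled t i. obs_dist (ob t) y v) = (\<Sum>v\<in>sampled t i. d y v)"
    using sampled_sub obs_dist_eq[OF assms] by (intro sum.cong) blast+
qed

lemma obs_guesses_eq:
  assumes "g \<notin> S t"
  shows "obs_guesses (ob t) i = guessed t i"
proof -
  have "obs_value (ob t) v = f v \<and> obs_dist (ob t) v (centre t i) = d v (centre t i)" if "v \<in> sampled t i" for v
    using that sampled_sub centre_S obs_simps(4) obs_dist_eq[OF assms] by blast
  then have "{v \<in> sampled t i. obs_value (ob t) v - int (obs_dist (ob t) v (centre t i)) = D}
    = {v \<in> sampled t i. f v - int (d v (centre t i)) = D}" for D by auto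
  then show ?thesis
    unfolding obs_guesses_def guessed_def guesses_def obs_centre_eq[OF assms] obs_simps(1) sampled_def[symmetric]
    using obs_simps(4) centre_S by simp
qed

lemma obs_mistakes_eq:
  assumes o: "g \<notin> S t" and b: "b \<in> boundary V E (S t)"
  shows "obs_mistakes (ob t) i D b = misfit t i D b"
proof -
  let ?K = "S t \<union> boundary V E (S t)" and ?c = "centre t i"
  have nb: "v \<in> ?K" if "u \<in> S t" "{u, v} \<in> E" for u v
    using that adj_V[OF that(2)] unfolding boundary_def by blast
  have dc: "obs_dist (ob t) ?c v = d ?c v" if "v \<in> ?K" for v using obs_dist_eq[OF o] that centre_S by blast
  have fam: "{v. v = u \<or> {u, v} \<in> {e \<in> E. e \<subseteq> ?K} \<and> obs_dist (ob t) ?c v = Suc (obs_dist (ob t) ?c u)}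
    = {v. v = u \<or> {u, v} \<in> E \<and> d ?c v = Suc (d ?c u)}" if u: "u \<in> S t" for u
    using nb[OF u] dc u by auto
  have "(\<forall>v\<in>{v. v = u \<or> {u, v} \<in> {e \<in> E. e \<subseteq> ?K} \<and> obs_dist (ob t) ?c v = Suc (obs_dist (ob t) ?c u)}.
      obs_value (ob t) v = int (obs_dist (ob t) v b) + D - int (obs_dist (ob t) ?c b))
    \<longleftrightarrow> (\<forall>v\<in>{v. v = u \<or> {u, v} \<in> E \<and> d ?c v = Suc (d ?c u)}. f v = int (d v b) + D - int (d ?c b))"
    if u: "u \<in> S t" for u
    unfolding fam[OF u]
  proof (rule ball_cong[OF refl])
    fix v assume "v \<in> {v. v = u \<or> {u, v} \<in> E \<and> d ?c v = Suc (d ?c u)}"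
    then have "v \<in> ?K" using nb[OF u] u by blast
    then show "(obs_value (ob t) v = int (obs_dist (ob t) v b) + D - int (obs_dist (ob t) ?c b))
      = (f v = int (d v b) + D - int (d ?c b))"
      using obs_simps(4) obs_dist_eq[OF o] centre_S b by simp
  qed
  note eq = this
  show ?thesis
    unfolding obs_mistakes_def misfit_def mistakes_def obs_centre_eq[OF o] obs_simps(1,3)
    by (intro arg_cong[where f = card] Collect_cong conj_cong refl arg_cong[where f = Not] eq)
qed

lemma obs_alive_eq:
  assumes "g \<notin> S t"
  shows "obs_plausible (ob t) i D = candidates t i D" "obs_alive (ob t) i = alive t i"
    "obs_phase (ob t) = phase t"
proof -
  show candidates: "obs_plausible (ob t) i D = candidates t i D" for i D
    unfolding obs_plausible_def candidates_def obs_simps using obs_mistakes_eq[OF assms] by auto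
  show al: "obs_alive (ob t) i = alive t i" for i
    unfolding obs_alive_def alive_def candidates obs_guesses_eq[OF assms] ..
  show "obs_phase (ob t) = phase t" unfolding obs_phase_def phase_def al ..
qed

lemma guessed_finite: "finite (guessed t i)"
  unfolding guessed_def by (rule guesses_finite[OF sampled_finite])

lemma alive_finite: "finite (alive t i)"
  unfolding alive_def using guessed_finite by simp

lemma misfit_le: "misfit t i D b \<le> card (S t)"
  unfolding misfit_def mistakes_def by (rule card_mono) auto

text \<open>The guess \<open>f\<close> of the centre is always available, and a hypothesis cannot
  make more mistakes than there are visited vertices.\<close>

lemma alive_if_small:
  assumes "g \<notin> S t" "Suc t \<le> tolerance i"
  shows "alive t i \<noteq> {}"
proof -
  have "f (centre t i) \<in> guessed t i" unfolding guessed_def guesses_def by blast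
  moreover obtain b where "b \<in> boundary V E (S t)" using x_boundary[OF assms(1)] by blast
  then have "b \<in> candidates t i (f (centre t i))"
    unfolding candidates_def using misfit_le[of t i "f (centre t i)" b] card_S[OF assms(1)] assms(2) by simp
  ultimately show ?thesis unfolding alive_def by blast
qed

lemma tolerance_ge: "4 * 2 ^ i \<le> tolerance i"
  unfolding tolerance_def using one_le_power[of "2::nat" i] by linarith

lemma sample_size_Suc: "sample_size (Suc i) = tolerance i"
  unfolding tolerance_def sample_size_def by simp

lemma tolerance_mono: "i \<le> j \<Longrightarrow> tolerance i \<le> tolerance j"
  unfolding tolerance_def using power_increasing[of i j "2::nat"] by linarith

lemma alive_phase:
  assumes "g \<notin> S t"
  shows "alive t (phase t) \<noteq> {}"
  unfolding phase_def
proof (rule LeastI)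
  have "Suc t < 2 ^ Suc t" by (rule less_exp)
  then have "Suc t \<le> tolerance (Suc t)" using tolerance_ge[of "Suc t"] by linarith
  then show "alive t (Suc t) \<noteq> {}" using alive_if_small assms by blast
qed

lemma guess_alive:
  assumes "g \<notin> S t"
  shows "guess t \<in> alive t (phase t)"
  unfolding guess_def using Min_in[OF alive_finite alive_phase[OF assms]] .

lemma not_alive_large:
  assumes "g \<notin> S t" "alive t i = {}"
  shows "tolerance i \<le> t"
proof (rule ccontr)
  assume "\<not> tolerance i \<le> t"
  then have "Suc t \<le> tolerance i" by simp
  then show False using alive_if_small assms by blast
qed

text \<open>The preceding phase has died, which takes as many visits as its tolerance, and this is
  the sample size of the present phase.\<close>

lemma sample_size_le:
  assumes "g \<notin> S t"
  shows "sample_size (phase t) \<le> t"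
proof (cases "phase t")
  case 0
  then show ?thesis unfolding sample_size_def by simp
next
  case (Suc i)
  then have "alive t i = {}" using not_less_Least[of i "\<lambda>i. alive t i \<noteq> {}"] unfolding phase_def by auto
  then show ?thesis using not_alive_large[OF assms] Suc sample_size_Suc by simp
qed

lemma sample_size_le_tolerance: "sample_size i \<le> tolerance i"
  unfolding tolerance_def sample_size_def using one_le_power[of "2::nat" i] by linarith

lemma err_eq:
  assumes "c \<in> V"
  shows "hypotheses.err V E c f D S' b = mistakes d E f c D S' b"
proof -
  interpret H: hypotheses V E c f D using assms unfolding hypotheses_def by (rule rooted_treeI)
  show ?thesis unfolding H.err_def H.right_def H.family_def mistakes_def ..
qed

lemma plausible_eq:
  assumes "g \<notin> S t"
  shows "hypotheses.plausible V E (centre t i) f D (tolerance i) (S t) = candidates t i D"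
proof -
  have c: "centre t i \<in> V" using centre_S S_V[OF assms] by blast
  interpret H: hypotheses V E "centre t i" f D using c unfolding hypotheses_def by (rule rooted_treeI)
  show ?thesis unfolding H.plausible_def candidates_def misfit_def using err_eq[OF c] by simp
qed

lemma centre_eq: "sample_size i \<le> s \<Longrightarrow> s \<le> t \<Longrightarrow> centre t i = centre s i \<and> guessed t i = guessed s i"
  unfolding centre_def guessed_def using sampled_eq[of i s] sampled_eq[of i t] by (simp add: centre_def)

text \<open>Once the sample is complete the centre is fixed, and mistakes only grow with
  \<open>S\<close>; so a guess never comes back to life.\<close>

lemma candidates_back:
  assumes o: "g \<notin> S t" and st: "sample_size i \<le> s" "s \<le> t" and ne: "candidates t i D \<noteq> {}"
  shows "candidates s i D \<noteq> {}"
proof -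
  obtain b where b: "b \<in> boundary V E (S t)" "misfit t i D b \<le> tolerance i" using ne unfolding candidates_def by blast
  have os: "g \<notin> S s" using o S_mono[OF st(2)] by blast
  have c: "centre t i = centre s i" using centre_eq[OF st] by simp
  have cV: "centre s i \<in> V" "centre s i \<in> S s" using centre_S S_V[OF os] by blast+
  interpret H: hypotheses V E "centre s i" f D using cV(1) unfolding hypotheses_def by (rule rooted_treeI)
  have "b \<in> V" "b \<notin> S s" using b(1) S_mono[OF st(2)] unfolding boundary_def by auto
  then obtain b' where b': "b' \<in> boundary V E (S s)" "H.anc b' b"
    using H.bd_anc_ex[OF S_closed[OF os] cV(2)] by blast
  then have "b' \<notin> S s" unfolding boundary_def by blast
  then have "H.err (S s) b' = H.err (S s) b" using H.err_anc[OF S_closed[OF os] cV(2) _ b'(2)] by blast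
  also have "\<dots> \<le> H.err (S t) b" using H.err_mono[OF S_mono[OF st(2)] S_V[OF o]] .
  also have "\<dots> \<le> tolerance i" using b(2) unfolding misfit_def c err_eq[OF cV(1)] .
  finally show ?thesis using b'(1) unfolding candidates_def misfit_def err_eq[OF cV(1)] by blast
qed

lemma phase_mono:
  assumes o: "g \<notin> S t" and st: "s \<le> t"
  shows "phase s \<le> phase t"
proof (rule ccontr)
  assume "\<not> phase s \<le> phase t"
  then have na: "alive s (phase t) = {}" using not_less_Least[of "phase t" "\<lambda>i. alive s i \<noteq> {}"] unfolding phase_def by auto
  have os: "g \<notin> S s" using o S_mono[OF st] by blast
  have "sample_size (phase t) \<le> s" using not_alive_large[OF os na] sample_size_le_tolerance le_trans by blast
  then have "guessed t (phase t) = guessed s (phase t)" "\<And>D. candidates t (phase t) D \<noteq> {} \<Longrightarrow> candidates s (phase t) D \<noteq> {}"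
    using centre_eq candidates_back[OF o] st by blast+
  then have "alive t (phase t) \<subseteq> alive s (phase t)" unfolding alive_def by auto
  then show False using na alive_phase[OF o] by blast
qed

text \<open>Within a phase the alive set only shrinks, so its minimum rises. Together with
  \<open>phase_mono\<close>, every pair of phase and guess is in use during one interval of times,
  which forms a run.\<close>

lemma guess_mono:
  assumes o: "g \<notin> S t" and st: "s \<le> t" and eq: "phase s = phase t"
  shows "guess s \<le> guess t"
proof -
  have os: "g \<notin> S s" using o S_mono[OF st] by blast
  have ss: "sample_size (phase t) \<le> s" using sample_size_le[OF os] eq by simp
  have "guessed t (phase t) = guessed s (phase t)" using centre_eq[OF ss st] by simp
  then have "alive t (phase t) \<subseteq> alive s (phase t)" unfolding alive_def using candidates_back[OF o ss st] by auto
  then have "guess t \<in> alive s (phase s)" using guess_alive[OF o] eq by auto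
  then show ?thesis unfolding guess_def using Min_le[OF alive_finite] by blast
qed

lemma x_choice:
  assumes o: "g \<notin> S t"
  defines "i \<equiv> phase t" and "D \<equiv> guess t" and "c \<equiv> centre t (phase t)"
  shows "x (Suc t) \<in> candidates t i D"
    "y \<in> candidates t i D \<Longrightarrow> 4 * misfit t i D (x (Suc t)) + d (x t) (x (Suc t)) + d c y
      \<le> 4 * misfit t i D y + d (x t) y + d c (x (Suc t))"
proof -
  define h where "h b = 4 * obs_mistakes (ob t) i D b + obs_dist (ob t) (x t) b
    + obs_dist (ob t) c (x t) - obs_dist (ob t) c b" for b
  have choice: "obs_choice (ob t) = arg_min h (\<lambda>b. b \<in> candidates t i D)"
    unfolding obs_choice_def Let_def obs_alive_eq(1-3)[OF o] obs_centre_eq[OF o] h_def i_def D_def c_def guess_def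
      obs_simps(1) position_def[symmetric] ..
  have "candidates t i D \<noteq> {}" using guess_alive[OF o] unfolding alive_def i_def D_def by blast
  then have in_candidates: "obs_choice (ob t) \<in> candidates t i D"
    unfolding choice using arg_min_natI[of "\<lambda>b. b \<in> candidates t i D"] by blast
  then have x: "x (Suc t) = obs_choice (ob t)"
    unfolding x_Suc explorer_def obs_simps candidates_def by simp
  then show xpl: "x (Suc t) \<in> candidates t i D" using in_candidates by simp
  have h: "h b + d c b = 4 * misfit t i D b + d (x t) b + d c (x t)" if "b \<in> candidates t i D" for b
  proof -
    have b: "b \<in> boundary V E (S t)" using that unfolding candidates_def by blast
    have V: "c \<in> V" "x t \<in> V" "b \<in> V"
      using centre_S x_in S_V[OF o] b unfolding c_def boundary_def by auto
    have "h b = 4 * misfit t i D b + d (x t) b + d c (x t) - d c b"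
      unfolding h_def obs_mistakes_eq[OF o b]
      using obs_dist_eq[OF o] b x_in[of t] centre_S[of t "phase t"] unfolding c_def by simp
    then show ?thesis using d_triangle[OF V] by linarith
  qed
  show "4 * misfit t i D (x (Suc t)) + d (x t) (x (Suc t)) + d c y
      \<le> 4 * misfit t i D y + d (x t) y + d c (x (Suc t))" if y: "y \<in> candidates t i D"
  proof -
    have "h (x (Suc t)) \<le> h y"
      unfolding x choice using arg_min_nat_le[of "\<lambda>b. b \<in> candidates t i D" y h] y by blast
    then show ?thesis using h[OF xpl] h[OF y] by linarith
  qed
qed

subsection \<open>The cost of a run\<close>

lemma neighbour_r:
  assumes "g \<notin> S 0"
  shows "1 \<le> max_degree V E"
proof -
  obtain b where b: "{r, b} \<in> E" using x_boundary[OF assms] unfolding boundary_def by auto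
  have "finite {v. {r, v} \<in> E}" by (rule finite_subset[OF _ finite_V]) (use adj_V in blast)
  then have "card {b} \<le> card {v. {r, v} \<in> E}" using b by (intro card_mono) auto
  then show ?thesis using degree_le[OF r] by simp
qed

lemma run_raw:
  assumes o: "g \<notin> S e" and ae: "a \<le> e"
    and key: "\<And>t. a \<le> t \<Longrightarrow> t \<le> e \<Longrightarrow> phase t = i \<and> guess t = D"
  shows "\<exists>b\<in>candidates a i D. (\<Sum>t = a..e. int (d (x t) (x (Suc t))))
    \<le> int (d (centre a i) (x (Suc e))) - int (d (centre a i) (x a))
      + (int (d (x a) b) + int (d (centre a i) (x a)) - int (d (centre a i) b))
      + 72 * int (max_degree V E) * int (misfit e i D (x (Suc e)))"
proof -
  have ot: "g \<notin> S t" if "t \<le> e" for t using o S_mono[OF that] by blast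
  have oa: "g \<notin> S a" using ot ae by blast
  have ss: "sample_size i \<le> a" using sample_size_le[OF oa] key[of a] ae by simp
  define c where "c = centre a i"
  have ct: "centre t i = c" if "a \<le> t" for t using centre_eq[OF ss that] unfolding c_def by simp
  have c: "c \<in> S a" "c \<in> V" using centre_S S_V[OF oa] unfolding c_def by blast+
  interpret H: hypotheses V E c f D using c(2) unfolding hypotheses_def by (rule rooted_treeI)
  have pe: "H.plausible (tolerance i) (S t) = candidates t i D" if "a \<le> t" "t \<le> e" for t
    using plausible_eq[OF ot[OF that(2)], of i D] ct[OF that(1)] by simp
  have me: "H.err (S t) b = misfit t i D b" if "a \<le> t" for t b
    unfolding misfit_def ct[OF that] by (rule err_eq[OF c(2)])
  interpret R: run V E c f D x S a e "tolerance i" "max_degree V E"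
  proof unfold_locales
    show "a \<le> e" by (rule ae)
    show "geod_closed (S a)" using S_closed[OF oa] .
    show "c \<in> S a" by (rule c)
    show "x a \<in> S a" by (rule x_in)
    show "1 \<le> max_degree V E" using neighbour_r ot[of 0] by simp
    fix t assume t: "a \<le> t" "t \<le> e"
    show "S (Suc t) = insert (x (Suc t)) (S t)" by (rule S_Suc)
    show "x (Suc t) \<in> H.plausible (tolerance i) (S t)"
      using x_choice(1)[OF ot[OF t(2)]] key[OF t] pe[OF t] by simp
    fix y assume "y \<in> H.plausible (tolerance i) (S t)"
    then have y: "y \<in> candidates t (phase t) (guess t)" using key[OF t] pe[OF t] by simp
    show "4 * H.err (S t) (x (Suc t)) + d (x t) (x (Suc t)) + d c y
      \<le> 4 * H.err (S t) y + d (x t) y + d c (x (Suc t))"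
      using x_choice(2)[OF ot[OF t(2)] y] key[OF t] ct[OF t(1)] me[OF t(1)] by simp
  qed (rule degree_le)
  obtain b where b: "b \<in> H.plausible (tolerance i) (S a)" "H.anc b R.z"
    using R.target_anc[OF order_refl ae] by blast
  have "card R.F = misfit e i D (x (Suc e))"
    unfolding R.F_def R.z_def me[OF ae, symmetric] H.err_def ..
  then show ?thesis
    using R.run_cost[OF b] b(1) pe[OF order_refl ae] unfolding R.z_def c_def by auto
qed

lemma centre_dist:
  assumes "g \<notin> S t" "sample_size i \<le> t"
  shows "d r (centre t i) \<le> sample_size i"
proof -
  have "centre t i \<in> S (sample_size i)" using centre_sampled sampled_eq[OF assms(2)] by blast
  then obtain j where "j \<le> sample_size i" "centre t i = x j" using S_elem by blast
  then show ?thesis using dist_x[OF assms(1), of j] assms(2) by simp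
qed

text \<open>Progress is measured from \<open>r\<close> instead of \<open>c\<close>, at the price of
  \<open>2 * d r c\<close>. After time 0 the initial climb is short by
  \<open>plausible_close\<close>, as \<open>x a\<close> was plausible when chosen and
  \<open>b\<close> is plausible now. The constant is \<open>620 = 72 * 8 + 36 + 8\<close>: mistakes
  of the run, initial climb, change of root.\<close>

lemma run_bound:
  assumes o: "g \<notin> S e" and ae: "a \<le> e"
    and key: "\<And>t. a \<le> t \<Longrightarrow> t \<le> e \<Longrightarrow> phase t = i \<and> guess t = D"
  shows "(\<Sum>t = a..e. int (d (x t) (x (Suc t))) - (int (d r (x (Suc t))) - int (d r (x t))))
    \<le> 620 * int (max_degree V E) * 2 ^ i"
proof -
  have ot: "g \<notin> S t" if "t \<le> e" for t using o S_mono[OF that] by blast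
  have oa: "g \<notin> S a" using ot ae by blast
  have ss: "sample_size i \<le> a" using sample_size_le[OF oa] key[of a] ae by simp
  define c where "c = centre a i"
  obtain b where b: "b \<in> candidates a i D" and raw: "(\<Sum>t = a..e. int (d (x t) (x (Suc t))))
    \<le> int (d c (x (Suc e))) - int (d c (x a)) + (int (d (x a) b) + int (d c (x a)) - int (d c b))
      + 72 * int (max_degree V E) * int (misfit e i D (x (Suc e)))"
    using run_raw[OF o ae key] unfolding c_def by blast
  have V: "c \<in> V" "x a \<in> V" "x (Suc e) \<in> V" "b \<in> V"
    using centre_S x_in S_V[OF oa] x_boundary[OF o] b unfolding c_def candidates_def boundary_def by blast+
  have rc: "d r c \<le> 4 * 2 ^ i"
    using centre_dist[OF oa ss] unfolding c_def sample_size_def by simp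
  have rc': "int (d r c) \<le> 4 * 2 ^ i"
  proof -
    have "int (d r c) \<le> int (4 * 2 ^ i)" using rc by (simp only: of_nat_le_iff)
    then show ?thesis by simp
  qed
  have tol: "tolerance i \<le> 8 * 2 ^ i" unfolding tolerance_def by simp
  have start: "int (d (x a) b) + int (d c (x a)) - int (d c b) \<le> 36 * 2 ^ i"
  proof (cases a)
    case 0
    then have "x a = r" using x_0 by simp
    then have "d (x a) b \<le> d (x a) c + d c b" "d c (x a) = d r c" "d (x a) c = d r c"
      using d_triangle[OF V(2,1,4)] d_sym[OF V(1,2)] by simp_all
    moreover have "(0::int) \<le> 2 ^ i" by simp
    ultimately show ?thesis using rc' by linarith
  next
    case (Suc a')
    define i' D' where "i' = phase a'" and "D' = guess a'"
    have oa': "g \<notin> S a'" using ot[of a'] Suc ae by simp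
    have p: "x a \<in> candidates a' i' D'" using x_choice(1)[OF oa'] Suc unfolding i'_def D'_def by simp
    have "i' \<le> i" using phase_mono[OF oa, of a'] Suc key[of a] ae unfolding i'_def by simp
    then have 1: "misfit a' i' D' (x a) \<le> tolerance i" using p tolerance_mono le_trans unfolding candidates_def by blast
    have 2: "misfit a i D b \<le> tolerance i" using b unfolding candidates_def by simp
    have Sa: "S a = insert (x a) (S a')" using S_Suc[of a'] Suc by simp
    have "x a \<in> boundary V E (S a')" "b \<in> boundary V E (insert (x a) (S a'))"
      using p b unfolding candidates_def Sa by simp_all
    from plausible_close[OF S_closed[OF oa'] this]
    have "d (x a) b \<le> misfit a' i' D' (x a) + misfit a i D b + 2" unfolding misfit_def Sa .
    then have "d (x a) b \<le> 2 * tolerance i + 2" using 1 2 by simp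
    moreover have "d c (x a) \<le> d c b + d (x a) b"
      using d_triangle[OF V(1,4,2)] d_sym[OF V(4,2)] by simp
    moreover have "(1::nat) \<le> 2 ^ i" by simp
    ultimately have "d (x a) b \<le> 18 * 2 ^ i" "d c (x a) \<le> d c b + d (x a) b"
      using tol by linarith+
    then have "int (d (x a) b) \<le> int (18 * 2 ^ i)" "int (d c (x a)) \<le> int (d c b + d (x a) b)"
      by (simp_all only: of_nat_le_iff)
    then show ?thesis by simp
  qed
  have "misfit e i D (x (Suc e)) \<le> tolerance i"
    using x_choice(1)[OF o] key[OF ae order_refl] unfolding candidates_def by simp
  then have "misfit e i D (x (Suc e)) \<le> 8 * 2 ^ i" using tol by linarith
  then have "max_degree V E * misfit e i D (x (Suc e)) \<le> max_degree V E * (8 * 2 ^ i)" by simp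
  then have "int (max_degree V E * misfit e i D (x (Suc e))) \<le> int (max_degree V E * (8 * 2 ^ i))"
    by (simp only: of_nat_le_iff)
  then have m: "int (max_degree V E) * int (misfit e i D (x (Suc e))) \<le> 8 * (int (max_degree V E) * 2 ^ i)"
    by simp
  have "d c (x (Suc e)) \<le> d r c + d r (x (Suc e))" "d r (x a) \<le> d r c + d c (x a)"
    using d_triangle[OF V(1) r V(3)] d_triangle[OF r V(1,2)] d_sym[OF r V(1)] by simp_all
  then have shift: "int (d c (x (Suc e))) - int (d c (x a))
    \<le> int (d r (x (Suc e))) - int (d r (x a)) + 2 * int (d r c)" by linarith
  have "1 \<le> max_degree V E" using neighbour_r ot[of 0] by simp
  then have W: "(2::int) ^ i \<le> int (max_degree V E) * 2 ^ i" by simp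
  have "(\<Sum>t = a..e. int (d r (x (Suc t))) - int (d r (x t))) = int (d r (x (Suc e))) - int (d r (x a))"
    using sum_Suc_diff[of a e "\<lambda>t. int (d r (x t))"] ae by simp
  moreover have "(\<Sum>t = a..e. int (d (x t) (x (Suc t))))
    \<le> int (d c (x (Suc e))) - int (d c (x a)) + (int (d (x a) b) + int (d c (x a)) - int (d c b))
      + 72 * (int (max_degree V E) * int (misfit e i D (x (Suc e))))"
    using raw by (simp only: mult.assoc)
  ultimately have "(\<Sum>t = a..e. int (d (x t) (x (Suc t))) - (int (d r (x (Suc t))) - int (d r (x t))))
    \<le> 620 * (int (max_degree V E) * 2 ^ i)"
    unfolding sum_subtractf using shift rc' start m W by linarith
  then show ?thesis by (simp only: mult.assoc)
qed

subsection \<open>Phases\<close>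

text \<open>Once the sample is complete, at least \<open>2 * 2 ^ i - 1\<close> of its vertices see
  \<open>g\<close> through the median and fewer than \<open>2 ^ i\<close> of them err, so the true
  distance is guessed. The hypothesis leading to \<open>g\<close> makes at most two mistakes per
  erroneous vertex and passes the test.\<close>

lemma truth_alive:
  assumes o: "g \<notin> S t" and e: "card (erroneous V E f g) < 2 ^ i"
  shows "alive t i \<noteq> {}"
proof (cases "sample_size i \<le> t")
  case False
  then show ?thesis using alive_if_small[OF o] sample_size_le_tolerance[of i] by simp
next
  case True
  let ?c = "centre t i"
  have c: "?c \<in> V" "?c \<in> S t" using centre_S S_V[OF o] by blast+
  have oi: "g \<notin> S (sample_size i)" using o S_mono[OF True] by blast
  have R: "sampled t i = S (sample_size i)" using sampled_eq[OF True] .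
  have RV: "sampled t i \<subseteq> V" using R S_V[OF oi] by simp
  define A where "A = {v \<in> sampled t i. d v g = d v ?c + d ?c g}"
  have finA: "finite A" unfolding A_def using sampled_finite by simp
  have "card (sampled t i) \<le> 2 * card A"
    unfolding A_def centre_def
  proof (rule median_majority(1))
    show "geod_closed (sampled t i)" using R S_closed[OF oi] by simp
    show "finite (sampled t i)" by (rule sampled_finite)
    show "sampled t i \<noteq> {}" by (rule sampled_nonempty)
    show "g \<in> V" by (rule g)
    show "g \<notin> sampled t i" using R oi by simp
  qed
  moreover have "card (sampled t i) = Suc (sample_size i)" using R card_S[OF oi] by simp
  moreover have "A - erroneous V E f g \<subseteq> {v \<in> sampled t i. f v - int (d v ?c) = int (d ?c g)}"
    using RV unfolding A_def erroneous_def by auto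
  then have "card (A - erroneous V E f g) \<le> card {v \<in> sampled t i. f v - int (d v ?c) = int (d ?c g)}"
    using sampled_finite by (intro card_mono) auto
  moreover have "card A \<le> card (A - erroneous V E f g) + card (erroneous V E f g)"
  proof -
    have fe: "finite (erroneous V E f g)" unfolding erroneous_def using finite_V by simp
    have "card A \<le> card ((A - erroneous V E f g) \<union> erroneous V E f g)"
      using finA fe by (intro card_mono) auto
    also have "\<dots> \<le> card (A - erroneous V E f g) + card (erroneous V E f g)" by (rule card_Un_le)
    finally show ?thesis .
  qed
  moreover have "(1::nat) \<le> 2 ^ i" by simp
  ultimately have "2 ^ i \<le> card {v \<in> sampled t i. f v - int (d v ?c) = int (d ?c g)}"
    using e unfolding sample_size_def by linarith
  then have guess: "int (d ?c g) \<in> guessed t i" unfolding guessed_def guesses_def by blast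
  interpret H: hypotheses V E ?c f "int (d ?c g)" using c(1) unfolding hypotheses_def by (rule rooted_treeI)
  obtain b where b: "b \<in> boundary V E (S t)" "H.anc b g" using H.bd_anc_ex[OF S_closed[OF o] c(2) g o] by blast
  then have "b \<notin> S t" unfolding boundary_def by blast
  then have "H.err (S t) b = H.err (S t) g" using H.err_anc[OF S_closed[OF o] c(2) _ b(2)] by blast
  then have "misfit t i (int (d ?c g)) b = mistakes d E f ?c (int (d ?c g)) (S t) g"
    unfolding misfit_def err_eq[OF c(1)] .
  also have "\<dots> \<le> 2 * card (erroneous V E f g)" by (rule mistakes_goal[OF c(1) S_V[OF o] g])
  also have "\<dots> \<le> tolerance i" using e tolerance_ge[of i] by linarith
  finally have "b \<in> candidates t i (int (d ?c g))" using b(1) unfolding candidates_def by blast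
  then show ?thesis unfolding alive_def using guess by blast
qed

lemma phase_le: "g \<notin> S t \<Longrightarrow> card (erroneous V E f g) < 2 ^ i \<Longrightarrow> phase t \<le> i"
  unfolding phase_def using truth_alive by (intro Least_le) blast

lemma goal_reached: "\<exists>t. g \<in> S t"
proof (rule ccontr)
  assume "\<nexists>t. g \<in> S t"
  then have "g \<notin> S (card V)" by blast
  then have "Suc (card V) \<le> card V"
    using card_S[of "card V"] card_mono[OF finite_V S_V[of "card V"]] by simp
  then show False by simp
qed

lemma first_reach:
  obtains n where "first_reaches explorer V E f r g n" "\<And>t. t < n \<Longrightarrow> g \<notin> S t"
proof -
  have ex: "\<exists>t. x t = g" using goal_reached S_elem by blast
  define n where "n = (LEAST t. x t = g)"
  have n: "x n = g" unfolding n_def using LeastI_ex[OF ex] .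
  have less: "x t \<noteq> g" if "t < n" for t using not_less_Least that unfolding n_def by blast
  have "g \<notin> S t" if "t < n" for t
  proof
    assume "g \<in> S t"
    then obtain j where "j \<le> t" "g = x j" using S_elem by blast
    then show False using less[of j] that by simp
  qed
  moreover have "first_reaches explorer V E f r g n" unfolding first_reaches_def using n less by blast
  ultimately show thesis using that by blast
qed

lemma movement_cost_alt: "movement_cost explorer V E f r n = (\<Sum>t<n. d (x t) (x (Suc t)))"
  unfolding movement_cost_def
  by (rule sum.reindex_bij_witness[of _ Suc "\<lambda>t. t - 1"]) auto

text \<open>The phase-wise bound leaves an additive term even without errors, so this case is
  treated directly: the only phase is 0, with centre \<open>r\<close> and the true distance as
  guess, and the extra terms of \<open>run_raw\<close> vanish.\<close>

lemma cost_exact: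
  assumes reach: "first_reaches explorer V E f r g n" "\<And>t. t < n \<Longrightarrow> g \<notin> S t"
    and e: "erroneous V E f g = {}"
  shows "movement_cost explorer V E f r n \<le> d r g"
proof (cases n)
  case 0
  then show ?thesis unfolding movement_cost_alt by simp
next
  case (Suc m)
  have o: "g \<notin> S t" if "t \<le> m" for t using reach(2) that Suc by simp
  have xn: "x (Suc m) = g" using reach(1) Suc unfolding first_reaches_def by simp
  have phase: "phase t = 0" if "t \<le> m" for t using phase_le[OF o[OF that], of 0] e by simp
  have sampled: "sampled t 0 = {r}" for t using sampled_eq[of 0 t] unfolding sample_size_def by simp
  have centre: "centre t 0 = r" for t using centre_sampled[of t 0] sampled by simp
  have guessed: "guessed t 0 \<subseteq> {f r}" for t
  proof
    fix D assume D: "D \<in> guessed t 0"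
    show "D \<in> {f r}"
    proof (cases "D = f r")
      case False
      then have "1 \<le> card {v \<in> {r}. f v - int (d v r) = D}"
        using D unfolding guessed_def guesses_def sampled centre by simp
      then have "{v \<in> {r}. f v - int (d v r) = D} \<noteq> {}" by (metis card.empty not_one_le_zero)
      then show ?thesis using r by auto
    qed simp
  qed
  have fr: "f r = int (d r g)" using e r unfolding erroneous_def by auto
  have guess: "guess t = int (d r g)" if "t \<le> m" for t
    using guess_alive[OF o[OF that]] phase[OF that] guessed[of t] fr unfolding alive_def by auto
  obtain b where raw: "(\<Sum>t = 0..m. int (d (x t) (x (Suc t))))
    \<le> int (d r g) - int (d r (x 0)) + (int (d (x 0) b) + int (d r (x 0)) - int (d r b))
      + 72 * int (max_degree V E) * int (misfit m 0 (int (d r g)) g)"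
    using run_raw[OF o[OF order_refl], of 0 0 "int (d r g)"] phase guess unfolding centre xn by blast
  have "misfit m 0 (int (d r g)) g = 0"
    using mistakes_goal[OF r S_V[OF o[OF order_refl]] g, where f = f] e unfolding misfit_def centre by simp
  then have "(\<Sum>t = 0..m. int (d (x t) (x (Suc t)))) \<le> int (d r g)" using raw r unfolding x_0 by simp
  moreover have "{0..m} = {..<n}" using Suc by auto
  ultimately have "int (\<Sum>t<n. d (x t) (x (Suc t))) \<le> int (d r g)" by simp
  then show ?thesis unfolding movement_cost_alt by linarith
qed

text \<open>Moves are grouped by phase and guess. Each nonempty group is one run and a phase has at
  most four guesses, so up to the degree phase \<open>i\<close> contributes
  \<open>4 * 620 * 2 ^ i\<close>, a geometric series. The progress towards \<open>g\<close>
  telescopes over all moves.\<close>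

lemma cost_phases:
  assumes reach: "first_reaches explorer V E f r g n" "\<And>t. t < n \<Longrightarrow> g \<notin> S t"
    and e: "card (erroneous V E f g) < 2 ^ I"
  shows "int (movement_cost explorer V E f r n) \<le> int (d r g) + 4960 * int (max_degree V E) * 2 ^ I"
proof (cases n)
  case 0
  then show ?thesis unfolding movement_cost_alt by simp
next
  case (Suc m)
  define key where "key t = (phase t, guess t)" for t
  define h where "h t = int (d (x t) (x (Suc t))) - (int (d r (x (Suc t))) - int (d r (x t)))" for t
  \<comment> \<open>The guesses of a phase are fixed once its sample is complete, so those computed
    at the final time \<open>m\<close> comprise all that were used.\<close>
  define Keys where "Keys = (SIGMA i:{..I}. guessed m i)"
  have card_guessed: "finite (guessed m i)" "card (guessed m i) \<le> 4" for i
  proof -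
    show "finite (guessed m i)" by (rule guessed_finite)
    have "card (sampled m i) \<le> Suc (sample_size i)"
      unfolding sampled_def sample_def by (rule le_trans[OF card_length]) simp
    then show "card (guessed m i) \<le> 4" unfolding guessed_def using guesses_card[OF sampled_finite] by blast
  qed
  have finK: "finite Keys" unfolding Keys_def using card_guessed by (intro finite_SigmaI) auto
  have inK: "key ` {..<n} \<subseteq> Keys"
  proof
    fix k assume "k \<in> key ` {..<n}"
    then obtain t where t: "t < n" "k = key t" by blast
    have o: "g \<notin> S t" using reach(2) t by blast
    have ss: "sample_size (phase t) \<le> t" "t \<le> m" using sample_size_le[OF o] t Suc by simp_all
    have "guess t \<in> guessed t (phase t)" using guess_alive[OF o] unfolding alive_def by blast
    then have "guess t \<in> guessed m (phase t)" using centre_eq[OF ss] by simp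
    then show "k \<in> Keys" unfolding Keys_def t(2) key_def using phase_le[OF o e] ss by simp
  qed
  have run: "(\<Sum>t\<in>{t \<in> {..<n}. key t = k}. h t) \<le> 620 * int (max_degree V E) * 2 ^ fst k" for k
  proof (cases "{t \<in> {..<n}. key t = k} = {}")
    case True
    then show ?thesis by (simp only: sum.empty) simp
  next
    case False
    define T where "T = {t \<in> {..<n}. key t = k}"
    have fin: "finite T" unfolding T_def by simp
    have Tne: "T \<noteq> {}" using False unfolding T_def .
    have mem: "Min T \<in> T" "Max T \<in> T" using fin Tne by simp_all
    have T_I: "t \<in> T" if "t < n" "key t = k" for t using that unfolding T_def by blast
    have T_D: "t < n \<and> key t = k" if "t \<in> T" for t using that unfolding T_def by blast
    have lt: "Max T < n" "key (Min T) = k" "key (Max T) = k" using T_D[OF mem(1)] T_D[OF mem(2)] by blast+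
    \<comment> \<open>Phase and guess are monotone, so between two times with equal key the key is
      constant.\<close>
    have same: "key t = k" if t: "Min T \<le> t" "t \<le> Max T" for t
    proof -
      have o: "g \<notin> S (Max T)" "g \<notin> S t" using reach(2) lt(1) t by simp_all
      have "phase (Min T) \<le> phase t" "phase t \<le> phase (Max T)" using phase_mono[OF o(2) t(1)] phase_mono[OF o(1) t(2)] .
      then have p: "phase (Min T) = phase t" "phase t = phase (Max T)" using lt unfolding key_def by auto
      have "guess (Min T) \<le> guess t" "guess t \<le> guess (Max T)"
        using guess_mono[OF o(2) t(1) p(1)] guess_mono[OF o(1) t(2) p(2)] .
      then show ?thesis using p lt unfolding key_def by auto
    qed
    have T_eq: "T = {Min T..Max T}"
    proof
      show "T \<subseteq> {Min T..Max T}" using fin by auto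
      show "{Min T..Max T} \<subseteq> T"
      proof
        fix t assume "t \<in> {Min T..Max T}"
        then have t: "Min T \<le> t" "t \<le> Max T" by simp_all
        show "t \<in> T" using T_I[OF le_less_trans[OF t(2) lt(1)] same[OF t]] .
      qed
    qed
    have "sum h T = (\<Sum>t = Min T..Max T. h t)" by (rule sum.cong[OF T_eq refl])
    also have "\<dots> \<le> 620 * int (max_degree V E) * 2 ^ fst k"
    proof -
      have 1: "g \<notin> S (Max T)" using reach(2)[OF lt(1)] .
      have 2: "Min T \<le> Max T" using Min_le[OF fin mem(2)] .
      have 3: "phase t = fst k \<and> guess t = snd k" if "Min T \<le> t" "t \<le> Max T" for t
        using same[OF that] unfolding key_def by auto
      show ?thesis unfolding h_def by (rule run_bound[OF 1 2 3])
    qed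
    finally show ?thesis unfolding T_def .
  qed
  have "(\<Sum>t<n. h t) = (\<Sum>k\<in>Keys. \<Sum>t\<in>{t \<in> {..<n}. key t = k}. h t)"
    by (rule sum.group[symmetric, OF _ finK inK]) simp
  also have "\<dots> \<le> (\<Sum>k\<in>Keys. 620 * int (max_degree V E) * 2 ^ fst k)" using run by (intro sum_mono) blast
  also have "\<dots> = (\<Sum>i\<le>I. \<Sum>D\<in>guessed m i. 620 * int (max_degree V E) * 2 ^ i)"
    unfolding Keys_def using card_guessed by (subst sum.Sigma) (auto intro!: sum.cong)
  also have "\<dots> = (\<Sum>i\<le>I. int (card (guessed m i)) * (620 * int (max_degree V E) * 2 ^ i))"
    by simp
  also have "\<dots> \<le> (\<Sum>i\<le>I. 4 * (620 * int (max_degree V E) * 2 ^ i))"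
  proof (intro sum_mono mult_right_mono)
    fix i show "int (card (guessed m i)) \<le> 4" using card_guessed(2)[of i] by linarith
  qed simp
  also have "\<dots> = 2480 * int (max_degree V E) * (\<Sum>i\<le>I. 2 ^ i)"
    by (simp add: sum_distrib_left mult.assoc)
  also have "\<dots> \<le> 2480 * int (max_degree V E) * (2 * 2 ^ I)"
  proof (rule mult_left_mono)
    have "(\<Sum>i\<le>I. (2::int) ^ i) = 2 ^ Suc I - 1" by (induction I) simp_all
    then show "(\<Sum>i\<le>I. (2::int) ^ i) \<le> 2 * 2 ^ I" by simp
  qed simp
  finally have "(\<Sum>t<n. h t) \<le> 4960 * int (max_degree V E) * 2 ^ I" by simp
  moreover have "(\<Sum>t<n. h t) = int (movement_cost explorer V E f r n) - (int (d r (x n)) - int (d r (x 0)))"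
    unfolding h_def movement_cost_alt sum_subtractf
    using sum_lessThan_telescope[of "\<lambda>t. int (d r (x t))" n] by (simp add: sum_subtractf)
  moreover have "x n = g" using reach(1) unfolding first_reaches_def by blast
  ultimately show ?thesis using r unfolding x_0 by simp
qed

lemma cost_bound:
  assumes reach: "first_reaches explorer V E f r g n" "\<And>t. t < n \<Longrightarrow> g \<notin> S t"
  shows "int (movement_cost explorer V E f r n)
    \<le> int (d r g) + 9920 * (int (max_degree V E) * int (card (erroneous V E f g)))"
proof (cases "erroneous V E f g = {}")
  case True
  then show ?thesis using cost_exact[OF reach True] by simp
next
  case False
  let ?e = "card (erroneous V E f g)"
  have "finite (erroneous V E f g)" unfolding erroneous_def using finite_V by simp
  then have pos: "0 < ?e" using False by (simp add: card_gt_0_iff)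
  \<comment> \<open>Minimality gives \<open>2 ^ I \<le> 2 * ?e\<close>, whence
    \<open>9920 = 2 * 4960\<close>.\<close>
  define I where "I = (LEAST I. ?e < 2 ^ I)"
  have I: "?e < 2 ^ I" unfolding I_def by (rule LeastI[of _ ?e]) (rule less_exp)
  then obtain J where J: "I = Suc J" using pos by (cases I) auto
  then have "\<not> ?e < 2 ^ J" using not_less_Least[of J "\<lambda>I. ?e < 2 ^ I"] unfolding I_def by simp
  then have "2 ^ I \<le> 2 * ?e" using J by simp
  then have "max_degree V E * 2 ^ I \<le> max_degree V E * (2 * ?e)" by simp
  then have "int (max_degree V E * 2 ^ I) \<le> int (max_degree V E * (2 * ?e))" by (simp only: of_nat_le_iff)
  then show ?thesis using cost_phases[OF reach I] by simp
qed

end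

(* Vertices are natural numbers, so that the constant C is one and the same for all finite trees
   (with a type variable for the vertices, it could depend on the vertex type).

   The denominator is min delta 1 and not delta: for delta <= 1 they agree, and for large delta
   the bound with denominator delta fails for every constant C. On the complete binary tree of
   height h with f constantly -1 an algorithm has to visit all 2^(h+1) - 1 vertices in the worst
   case, whereas h * (1 + delta) + 3 * C * (2^(h+1) - 1) / delta is smaller than that
   for delta = 6 * C and large h. *)
theorem mainTheorem1:
  shows "\<exists>C::real. C > 0 \<and> (\<forall>\<delta>::real. \<delta> > 0 \<longrightarrow>
    (\<exists>A :: nat observation \<Rightarrow> nat. exploration_algorithm A \<and>
      (\<forall>(V :: nat set) (E :: nat set set) (r :: nat) (g :: nat) (f :: nat \<Rightarrow> int).
        is_tree V E \<and> r \<in> V \<and> g \<in> V \<longrightarrow>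
        (\<exists>n. first_reaches A V E f r g n \<and>
          real (movement_cost A V E f r n) \<le>
            real (graph_dist V E r g) * (1 + \<delta>)
            + C * (real (max_degree V E) * real (card (erroneous V E f g)) / min \<delta> 1)))))"
proof (intro exI[of _ "9920::real"] conjI allI impI exI[of _ explorer] explorer_algorithm)
  fix \<delta> :: real and V :: "nat set" and E r g f
  assume \<delta>: "\<delta> > 0" and "is_tree V E \<and> r \<in> V \<and> g \<in> V"
  then interpret search V E f r g by unfold_locales auto
  obtain n where n: "first_reaches explorer V E f r g n" "\<And>t. t < n \<Longrightarrow> g \<notin> S t" using first_reach by blast
  define P where "P = real (max_degree V E) * real (card (erroneous V E f g))"
  have "real_of_int (int (movement_cost explorer V E f r n))
    \<le> real_of_int (int (d r g) + 9920 * (int (max_degree V E) * int (card (erroneous V E f g))))"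
    using cost_bound[OF n] by (simp only: of_int_le_iff)
  then have "real (movement_cost explorer V E f r n) \<le> real (d r g) + 9920 * P" unfolding P_def by simp
  \<comment> \<open>\<open>cost_bound\<close> has leading factor 1; this step and the next relax it
    to the form with \<delta>.\<close>
  also have "real (d r g) \<le> real (d r g) * (1 + \<delta>)" using \<delta> by (simp add: algebra_simps)
  also have "P \<le> P / min \<delta> 1"
  proof -
    have "0 < min \<delta> 1" "min \<delta> 1 \<le> 1" "0 \<le> P" using \<delta> unfolding P_def by simp_all
    then show ?thesis by (simp add: pos_le_divide_eq mult_left_le)
  qed
  finally show "\<exists>n. first_reaches explorer V E f r g n \<and> real (movement_cost explorer V E f r n)
    \<le> real (graph_dist V E r g) * (1 + \<delta>)
      + 9920 * (real (max_degree V E) * real (card (erroneous V E f g)) / min \<delta> 1)"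
    using n(1) unfolding P_def by auto
qed simp

end
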